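(* Let $(a,b)\in\mathcal E$. For any two distinct regular Weierstrass points of $L_{a,b}$ there is a cylinder in $L_{a,b}$ whose core curve passes through these two points.
   Context: $\mathcal E=\{(a,b)\in(0,1)^2:\ \frac1{1-a}=x+y\sqrt D,\ \frac1{1-b}=(1-x)+y\sqrt D,\ x,y\in\mathbb Q,\ D\in\mathbb Z_{>0}\}$. $L_{a,b}$ is the translation surface obtained from the flat torus $\mathbb R^2/\mathbb Z^2$ by removing the open rectangle $(0,a)\times(0,b)$ and identifying the two horizontal sides of the hole by a vertical translation and the two vertical sides by a horizontal translation; it lies in $\mathcal H(2)$ (genus 2, one zero, the image of the rectangle's corners). It is hyperelliptic, the hyperelliptic involution being induced by the rotation by $\pi$ about $(a/2,b/2)$. Its regular Weierstrass points are the five fixed points of this involution other than the zero. A cylinder is a maximal open annulus filled by parallel isotopic simple closed geodesics, isometric to $\mathbb R/w\mathbb Z\times(0,h)$; its core curve is the geodesic corresponding to $\mathbb R/w\mathbb Z\times\{h/2\}$. *)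

theory Defs
  imports Complex_Main
begin

definition in_E :: "real \<Rightarrow> real \<Rightarrow> bool" where
  "in_E a b \<longleftrightarrow> 0 < a \<and> a < 1 \<and> 0 < b \<and> b < 1 \<and>
     (\<exists>x\<in>\<rat>. \<exists>y\<in>\<rat>. \<exists>D::int. D > 0 \<and>
        1 / (1 - a) = x + y * sqrt (of_int D) \<and>
        1 / (1 - b) = (1 - x) + y * sqrt (of_int D))"

text \<open>Points of the plane are pairs. The open holes: all integer translates of the
  open rectangle (0,a) x (0,b).  The complement of the holes, modulo Z^2 and the
  gluing of opposite sides of the hole, is the surface L_{a,b}.\<close>
definition hole :: "real \<Rightarrow> real \<Rightarrow> (real \<times> real) set" where
  "hole a b = {p. 0 < frac (fst p) \<and> frac (fst p) < a \<and> 0 < frac (snd p) \<and> frac (snd p) < b}"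

text \<open>Canonical representative of the point of L_{a,b} represented by a point of the
  plane outside the holes.  Representatives lie in [0,1)^2; the left side of the hole
  is identified with the right side, the bottom side with the top side, and all four
  corners of the rectangle give the zero, canonically represented by (a,b).\<close>
definition canon :: "real \<Rightarrow> real \<Rightarrow> real \<times> real \<Rightarrow> real \<times> real" where
  "canon a b p = (let x = frac (fst p); y = frac (snd p) in
     if (x = 0 \<or> x = a) \<and> (y = 0 \<or> y = b) then (a, b)
     else if x = 0 \<and> y < b then (a, y)
     else if y = 0 \<and> x < a then (x, b)
     else (x, y))"

definition surf :: "real \<Rightarrow> real \<Rightarrow> (real \<times> real) set" where
  "surf a b = canon a b ` (- hole a b)"

definition zero_pt :: "real \<Rightarrow> real \<Rightarrow> real \<times> real" where
  "zero_pt a b = (a, b)"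

text \<open>The hyperelliptic involution induced by rotation by pi about (a/2,b/2).\<close>
definition hinv :: "real \<Rightarrow> real \<Rightarrow> real \<times> real \<Rightarrow> real \<times> real" where
  "hinv a b p = canon a b (a - fst p, b - snd p)"

definition regular_weierstrass :: "real \<Rightarrow> real \<Rightarrow> (real \<times> real) set" where
  "regular_weierstrass a b = {p \<in> surf a b. hinv a b p = p \<and> p \<noteq> zero_pt a b}"

definition mv :: "real \<times> real \<Rightarrow> real \<Rightarrow> real \<times> real \<Rightarrow> real \<times> real" where
  "mv q c u = (fst q + c * fst u, snd q + c * snd u)"

definition perp :: "real \<times> real \<Rightarrow> real \<times> real" where
  "perp u = (- snd u, fst u)"

text \<open>g : I -> L_{a,b} is a unit-speed straight-line (geodesic) path in direction u
  avoiding the zero: near every parameter t it is, on each side, the image of a straight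
  segment of the plane in direction u that stays outside the holes.\<close>
definition flow_line :: "real \<Rightarrow> real \<Rightarrow> real \<times> real \<Rightarrow> (real \<Rightarrow> real \<times> real) \<Rightarrow> real set \<Rightarrow> bool" where
  "flow_line a b u g I \<longleftrightarrow>
     (\<forall>t\<in>I. g t \<noteq> zero_pt a b \<and>
        (\<exists>\<delta>>0. \<exists>q1 q2.
           (\<forall>s\<in>I. t - \<delta> < s \<and> s \<le> t \<longrightarrow>
               mv q1 (s - t) u \<notin> hole a b \<and> canon a b (mv q1 (s - t) u) = g s) \<and>
           (\<forall>s\<in>I. t \<le> s \<and> s < t + \<delta> \<longrightarrow>
               mv q2 (s - t) u \<notin> hole a b \<and> canon a b (mv q2 (s - t) u) = g s)))"

text \<open>A flat cylinder R/wZ x (0,h) mapped isometrically (as a translation-surface map)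
  and injectively into L_{a,b}: the circles r = const are closed geodesics in the unit
  direction u, the segments t = const are geodesics in the perpendicular direction.\<close>
definition is_cyl :: "real \<Rightarrow> real \<Rightarrow> real \<times> real \<Rightarrow> real \<Rightarrow> real \<Rightarrow> (real \<Rightarrow> real \<Rightarrow> real \<times> real) \<Rightarrow> bool" where
  "is_cyl a b u w h \<Phi> \<longleftrightarrow>
     (fst u)\<^sup>2 + (snd u)\<^sup>2 = 1 \<and> 0 < w \<and> 0 < h \<and>
     (\<forall>t r. 0 < r \<and> r < h \<longrightarrow> \<Phi> (t + w) r = \<Phi> t r) \<and>
     inj_on (\<lambda>(t, r). \<Phi> t r) ({0..<w} \<times> {0<..<h}) \<and>
     (\<forall>r\<in>{0<..<h}. flow_line a b u (\<lambda>t. \<Phi> t r) UNIV) \<and>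
     (\<forall>t. flow_line a b (perp u) (\<lambda>r. \<Phi> t r) {0<..<h})"

definition cyl_image :: "real \<Rightarrow> (real \<Rightarrow> real \<Rightarrow> real \<times> real) \<Rightarrow> (real \<times> real) set" where
  "cyl_image h \<Phi> = {\<Phi> t r | t r. 0 < r \<and> r < h}"

definition cylinder :: "real \<Rightarrow> real \<Rightarrow> real \<times> real \<Rightarrow> real \<Rightarrow> real \<Rightarrow> (real \<Rightarrow> real \<Rightarrow> real \<times> real) \<Rightarrow> bool" where
  "cylinder a b u w h \<Phi> \<longleftrightarrow> is_cyl a b u w h \<Phi> \<and>
     \<not> (\<exists>u' w' h' \<Phi>'. is_cyl a b u' w' h' \<Phi>' \<and> cyl_image h \<Phi> \<subset> cyl_image h' \<Phi>')"

definition core_through :: "real \<Rightarrow> (real \<Rightarrow> real \<Rightarrow> real \<times> real) \<Rightarrow> real \<times> real \<Rightarrow> bool" where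
  "core_through h \<Phi> p \<longleftrightarrow> (\<exists>t. \<Phi> t (h / 2) = p)"

end

theory Submission
  imports Defs "HOL-Analysis.Analysis"
begin

text \<open>Up to exchanging the coordinates, any two regular Weierstrass points lie on the core of a
  horizontal cylinder or on a closed geodesic that is invariant under the involution and crosses each
  of the two horizontal cylinders at most twice. The latter unfolds to a line in the plane, and shifting
  it sideways until a corner of a hole is met gives a cylinder with this core; by symmetry both
  boundary components meet a corner at the same time. Varying the number of twists \<open>N\<close>, the place
  where the line crosses from one horizontal cylinder into the other moves by steps shorter than the
  side available there, so a suitable \<open>N\<close> of prescribed parity exists for all \<open>0 < a, b < 1\<close>.

  For maximality: on a larger cylinder, the coordinate across that cylinder is affine along the core
  and bounded, hence constant. So the larger cylinder is parallel to the given one and extends it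
  over a boundary point, where the distance to the corners tends to zero, which is impossible at
  a nonsingular point.\<close>

text \<open>The horizontal cylinders are a small one of circumference \<open>1 - a\<close> and
  height \<open>b\<close> beside the hole and a large one of circumference 1 and height
  \<open>1 - b\<close> above it. A symmetric line of inverse slope \<sigma> crosses the top and the
  bottom of the small cylinder at points symmetric about \<open>(1 + a) / 2\<close>, whose
  difference is D = N (1 - a) + \<sigma> b. It closes up if \<sigma> + N (1 - a) = k, or \<sigma> (2
  - b) + N (1 - a) = k with two passes through the large cylinder. Eliminating \<sigma> gives D = N
  (1 - a) (1 - b) + k b, respectively (2 - b) D = N (1 - a) (2 - 2 b) + k b. The condition on the
  crossings is |D| < 1 - a, and changing N by 2 moves D by less than 2 (1 - a). The parities of N
  and k decide which Weierstrass points are met. An obstacle on the geometric side is that the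
  surface is a set of normal forms under the discontinuous map \<open>canon\<close>, and that points
  on the sides of the hole have two lifts. Uniqueness of continuation and the Hausdorff property are
  therefore drawn from germs of plane displacements and from continuous functions that respect the
  gluing.\<close>

lemma eventually_nhds_0_prod_iff:
  "(\<forall>\<^sub>F v in nhds (0::real \<times> real). P v) \<longleftrightarrow>
     (\<exists>\<delta>>0. \<forall>v. \<bar>fst v\<bar> < \<delta> \<longrightarrow> \<bar>snd v\<bar> < \<delta> \<longrightarrow> P v)"
proof
  assume "\<forall>\<^sub>F v in nhds 0. P v"
  then obtain d where d: "d > 0" "\<And>v. dist v 0 < d \<Longrightarrow> P v"
    by (auto simp: eventually_nhds_metric)
  show "\<exists>\<delta>>0. \<forall>v. \<bar>fst v\<bar> < \<delta> \<longrightarrow> \<bar>snd v\<bar> < \<delta> \<longrightarrow> P v"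
  proof (intro exI[of _ "d/2"] conjI allI impI)
    fix v :: "real \<times> real" assume "\<bar>fst v\<bar> < d/2" "\<bar>snd v\<bar> < d/2"
    then have "norm v < d"
      using norm_Pair_le[of "fst v" "snd v"] by simp
    then show "P v" using d by simp
  qed (use d in simp)
next
  assume "\<exists>\<delta>>0. \<forall>v. \<bar>fst v\<bar> < \<delta> \<longrightarrow> \<bar>snd v\<bar> < \<delta> \<longrightarrow> P v"
  then obtain d where d: "d > 0" "\<And>v. \<bar>fst v\<bar> < d \<Longrightarrow> \<bar>snd v\<bar> < d \<Longrightarrow> P v" by auto
  show "\<forall>\<^sub>F v in nhds 0. P v"
    unfolding eventually_nhds_metric
  proof (intro exI[of _ d] conjI allI impI)
    fix v :: "real \<times> real" assume "dist v 0 < d"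
    then have "norm v < d" by simp
    then show "P v"
      using d(2) norm_fst_le[of "fst v" "snd v"] norm_snd_le[of "snd v" "fst v"] by simp
  qed (use d in simp)
qed

lemma eventually_abs_less: "0 < c \<Longrightarrow> \<forall>\<^sub>F v in nhds (0::real \<times> real). \<bar>fst v\<bar> < c \<and> \<bar>snd v\<bar> < c"
  unfolding eventually_nhds_0_prod_iff by auto

section \<open>Fractional parts, lifts and the exponential map\<close>

declare frac_gt_0_iff [simp del] frac_eq_0_iff [simp del]

lemma frac_eqI: "0 \<le> x - of_int n \<Longrightarrow> x - of_int n < 1 \<Longrightarrow> frac x = x - of_int n"
  by (subst frac_unique_iff) auto

lemma frac_add_frac_left: "frac (frac x + y) = frac (x + y)"
  by (simp add: frac_def algebra_simps)

lemma frac_unit: "0 \<le> x \<Longrightarrow> x < 1 \<Longrightarrow> frac x = x"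
  using frac_eqI[of x 0] by simp

lemma frac_neg_unit: "-1 \<le> x \<Longrightarrow> x < 0 \<Longrightarrow> frac x = x + 1"
  using frac_eqI[of x "-1"] by simp

text \<open>A small displacement \<open>v\<close> of a nonsingular point \<open>z\<close> is carried out in the plane, starting
  at the lift of \<open>z\<close> from which \<open>v\<close> does not enter a hole. This gives the exponential map of
  the surface, by which all local statements below are phrased; its germ at \<open>z\<close> has no
  preferred direction, so strips and lines in any direction can be compared.\<close>
definition rep :: "real \<Rightarrow> real \<Rightarrow> real \<times> real \<Rightarrow> real \<times> real \<Rightarrow> real \<times> real" where
  "rep a b z v =
     (if fst z = a \<and> 0 < snd z \<and> snd z < b \<and> fst v < 0 then (0, snd z)
      else if snd z = b \<and> 0 < fst z \<and> fst z < a \<and> snd v < 0 then (fst z, 0)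
      else z)"

definition expo :: "real \<Rightarrow> real \<Rightarrow> real \<times> real \<Rightarrow> real \<times> real \<Rightarrow> real \<times> real" where
  "expo a b z v = canon a b (rep a b z v + v)"

definition regpt :: "real \<Rightarrow> real \<Rightarrow> real \<times> real \<Rightarrow> bool" where
  "regpt a b z \<longleftrightarrow> z \<in> surf a b \<and> z \<noteq> (a, b)"

locale holed_torus =
  fixes a b :: real
  assumes a0: "0 < a" and a1: "a < 1" and b0: "0 < b" and b1: "b < 1"
begin

lemma canon_frac: "canon a b (frac x, frac y) = canon a b (x, y)"
  by (simp add: canon_def)

lemma canon_frac_add: "canon a b ((frac x, frac y) + v) = canon a b ((x, y) + v)"
  by (cases v) (simp add: canon_def frac_add_frac_left)

lemma hole_frac_add: "(frac x, frac y) + v \<in> hole a b \<longleftrightarrow> (x, y) + v \<in> hole a b"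
  unfolding hole_def by (simp only: fst_add snd_add fst_conv snd_conv frac_add_frac_left mem_Collect_eq)

lemma canon_of_unit:
  assumes "0 \<le> x" "x < 1" "0 \<le> y" "y < 1"
  shows "canon a b (x, y) =
    (if (x = 0 \<or> x = a) \<and> (y = 0 \<or> y = b) then (a, b)
     else if x = 0 \<and> y < b then (a, y)
     else if y = 0 \<and> x < a then (x, b)
     else (x, y))"
  using assms by (simp add: canon_def frac_unit)

lemma hole_of_unit:
  assumes "0 \<le> x" "x < 1" "0 \<le> y" "y < 1"
  shows "(x, y) \<in> hole a b \<longleftrightarrow> 0 < x \<and> x < a \<and> 0 < y \<and> y < b"
  using assms by (simp add: hole_def frac_unit)

text \<open>\<open>canon\<close> and \<open>hole\<close> see coordinates only modulo 1, so a plane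
  point may be replaced by its reduction to the unit square; a single reduction serves all
  displacements \<open>v\<close>.\<close>

lemma unit_repr:
  obtains x y where "0 \<le> x" "x < 1" "0 \<le> y" "y < 1"
    "\<And>v. canon a b (p + v) = canon a b ((x, y) + v)"
    "\<And>v. p + v \<in> hole a b \<longleftrightarrow> (x, y) + v \<in> hole a b"
  by (rule that[of "frac (fst p)" "frac (snd p)"])
    (use frac_lt_1 frac_ge_0 canon_frac_add[of "fst p" "snd p"] hole_frac_add[of "fst p" "snd p"] in simp_all)

lemma canon_idem: "canon a b (canon a b p) = canon a b p"
  and canon_notin_hole: "p \<notin> hole a b \<Longrightarrow> canon a b p \<notin> hole a b"
proof -
  obtain x y where xy: "0 \<le> x" "x < 1" "0 \<le> y" "y < 1"
    and p: "canon a b p = canon a b (x, y)" "p \<in> hole a b \<longleftrightarrow> (x, y) \<in> hole a b"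
    using unit_repr[of p] by (metis add.right_neutral)
  show "canon a b (canon a b p) = canon a b p"
    unfolding p canon_of_unit[OF xy] using xy a0 a1 b0 b1
    by (cases "x = 0"; cases "y = 0"; cases "x = a"; cases "y = b") (simp_all add: canon_of_unit)
  show "canon a b p \<notin> hole a b" if "p \<notin> hole a b"
    using that unfolding p canon_of_unit[OF xy] hole_of_unit[OF xy] using xy a0 a1 b0 b1
    by (cases "x = 0"; cases "y = 0"; cases "x = a"; cases "y = b") (simp_all add: hole_of_unit)
qed

lemma surf_iff: "z \<in> surf a b \<longleftrightarrow> z \<notin> hole a b \<and> canon a b z = z"
proof
  assume "z \<in> surf a b"
  then obtain p where "z = canon a b p" "p \<notin> hole a b" unfolding surf_def by auto
  then show "z \<notin> hole a b \<and> canon a b z = z" using canon_idem canon_notin_hole by metis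
next
  assume "z \<notin> hole a b \<and> canon a b z = z"
  then show "z \<in> surf a b" unfolding surf_def by (metis ComplI imageI)
qed

lemma canon_cases:
  assumes "0 \<le> x" "x < 1" "0 \<le> y" "y < 1" "(x, y) \<notin> hole a b" "canon a b (x, y) \<noteq> (a, b)"
  obtains (left) "x = 0" "0 < y" "y < b" "canon a b (x, y) = (a, y)"
    | (right) "x = a" "0 < y" "y < b" "canon a b (x, y) = (a, y)"
    | (bot) "y = 0" "0 < x" "x < a" "canon a b (x, y) = (x, b)"
    | (top) "y = b" "0 < x" "x < a" "canon a b (x, y) = (x, b)"
    | (off) "x > a \<or> y > b" "canon a b (x, y) = (x, y)"
proof -
  note c = canon_of_unit[OF assms(1-4)]
  have nc: "\<not> ((x = 0 \<or> x = a) \<and> (y = 0 \<or> y = b))" using assms(6) c by metis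
  have nh: "\<not> (0 < x \<and> x < a \<and> 0 < y \<and> y < b)" using assms(5) hole_of_unit[OF assms(1-4)] by simp
  consider "x > a \<or> y > b" | "x = 0" "y < b" | "x = a" "y < b" | "y = 0" "x < a" | "y = b" "x < a"
    using nc nh assms(1-4) by linarith
  then show thesis
  proof cases
    case 1 show thesis by (intro off) (use c nc 1 a0 b0 assms(1,3) in auto)
  next
    case 2 show thesis by (intro left) (use c nc 2 a0 b0 assms(1,3) in auto)
  next
    case 3 show thesis by (intro right) (use c nc 3 a0 b0 assms(1,3) in auto)
  next
    case 4 show thesis by (intro bot) (use c nc 4 a0 b0 assms(1,3) in auto)
  next
    case 5 show thesis by (intro top) (use c nc 5 a0 b0 assms(1,3) in auto)
  qed
qed

text \<open>A displacement into the hole is excluded by the premise. On the left or bottom side, one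
  that leads away from the hole starts at the lift chosen by \<open>rep\<close>, and one along the
  side is carried by \<open>canon\<close> to the opposite side, where \<open>rep\<close> stays.
  Hence the germ does not depend on the lift.\<close>

lemma expo_canon_aux:
  assumes q: "0 \<le> x" "x < 1" "0 \<le> y" "y < 1" "(x, y) \<notin> hole a b" "canon a b (x, y) \<noteq> (a, b)"
  shows "\<forall>\<^sub>F v in nhds 0. (x, y) + v \<notin> hole a b \<longrightarrow>
            canon a b ((x, y) + v) = expo a b (canon a b (x, y)) v"
  using q
proof (cases rule: canon_cases)
  case left
  have "min (min a (1 - a)) (min y (b - y)) > 0" using left a0 a1 by auto
  from eventually_abs_less[OF this] show ?thesis
  proof eventually_elim
    case (elim v)
    obtain s t where v: "v = (s, t)" by force
    from elim have y: "0 < y + t" "y + t < b" "y + t < 1" and s: "s < a" "s < 1" "-s < 1"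
      using b1 a1 by (auto simp: v)
    consider "s < 0" | "s = 0" | "s > 0" by linarith
    then show ?case
    proof cases
      case 1
      then show ?thesis using left by (simp add: expo_def rep_def v)
    next
      case 2
      then show ?thesis using left y a0 a1 by (simp add: expo_def rep_def v canon_of_unit)
    next
      case 3
      then show ?thesis using left y s by (simp add: v hole_of_unit)
    qed
  qed
next
  case right
  have "min (min a (1 - a)) (min y (b - y)) > 0" using right a0 a1 by auto
  from eventually_abs_less[OF this] show ?thesis
  proof eventually_elim
    case (elim v)
    obtain s t where v: "v = (s, t)" by force
    from elim have y: "0 < y + t" "y + t < b" "y + t < 1" and s: "0 < a + s" "a + s < 1"
      using b1 a1 by (auto simp: v)
    show ?case
    proof (cases "s < 0")
      case True
      then show ?thesis using right y s by (simp add: v hole_of_unit)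
    next
      case False
      then show ?thesis using right b1 by (simp add: expo_def rep_def v)
    qed
  qed
next
  case bot
  have "min (min b (1 - b)) (min x (a - x)) > 0" using bot b0 b1 by auto
  from eventually_abs_less[OF this] show ?thesis
  proof eventually_elim
    case (elim v)
    obtain s t where v: "v = (s, t)" by force
    from elim have x: "0 < x + s" "x + s < a" "x + s < 1" and t: "t < b" "t < 1" "-t < 1"
      using b1 a1 by (auto simp: v)
    consider "t < 0" | "t = 0" | "t > 0" by linarith
    then show ?case
    proof cases
      case 1
      then show ?thesis using bot by (simp add: expo_def rep_def v)
    next
      case 2
      then show ?thesis using bot x b0 b1 by (simp add: expo_def rep_def v canon_of_unit)
    next
      case 3
      then show ?thesis using bot x t by (simp add: v hole_of_unit)
    qed
  qed
next
  case top
  have "min (min b (1 - b)) (min x (a - x)) > 0" using top b0 b1 by auto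
  from eventually_abs_less[OF this] show ?thesis
  proof eventually_elim
    case (elim v)
    obtain s t where v: "v = (s, t)" by force
    from elim have x: "0 < x + s" "x + s < a" "x + s < 1" and t: "0 < b + t" "b + t < 1"
      using b1 a1 by (auto simp: v)
    show ?case
    proof (cases "t < 0")
      case True
      then show ?thesis using top x t by (simp add: v hole_of_unit)
    next
      case False
      then show ?thesis using top b1 by (simp add: expo_def rep_def v)
    qed
  qed
next
  case off
  then show ?thesis by (intro always_eventually) (auto simp: expo_def rep_def)
qed

lemma expo_canon:
  assumes "q \<notin> hole a b" "canon a b q \<noteq> (a, b)"
  shows "\<forall>\<^sub>F v in nhds 0. q + v \<notin> hole a b \<longrightarrow> canon a b (q + v) = expo a b (canon a b q) v"
proof -
  obtain x y where xy: "0 \<le> x" "x < 1" "0 \<le> y" "y < 1"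
    and p: "\<And>v. canon a b (q + v) = canon a b ((x, y) + v)"
      "\<And>v. q + v \<in> hole a b \<longleftrightarrow> (x, y) + v \<in> hole a b"
    using unit_repr[of q] by metis
  have p0: "canon a b q = canon a b (x, y)" "(x, y) \<notin> hole a b"
    using assms(1) p[of 0] by simp_all
  show ?thesis using expo_canon_aux[OF xy p0(2)] assms(2) by (simp add: p p0(1))
qed

lemma canon_unit:
  "0 \<le> fst (canon a b p)" "fst (canon a b p) < 1" "0 \<le> snd (canon a b p)" "snd (canon a b p) < 1"
  using a0 a1 b0 b1 frac_lt_1[of "fst p"] frac_lt_1[of "snd p"] frac_ge_0[of "fst p"] frac_ge_0[of "snd p"]
  by (simp_all add: canon_def Let_def)

lemma regpt_cases:
  assumes "regpt a b z"
  obtains (vert) y where "z = (a, y)" "0 < y" "y < b"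
    | (horiz) x where "z = (x, b)" "0 < x" "x < a"
    | (off) x y where "z = (x, y)" "0 \<le> x" "x < 1" "0 \<le> y" "y < 1" "x > a \<or> y > b"
proof -
  obtain x y where z: "z = (x, y)" by force
  have c: "canon a b (x, y) = (x, y)" and "(x, y) \<notin> hole a b" "(x, y) \<noteq> (a, b)"
    using assms surf_iff by (auto simp: regpt_def z)
  moreover have "0 \<le> x" "x < 1" "0 \<le> y" "y < 1"
    using canon_unit[of "(x, y)"] by (simp_all add: c)
  moreover have "canon a b (x, y) \<noteq> (a, b)" using calculation by simp
  ultimately have u: "0 \<le> x" "x < 1" "0 \<le> y" "y < 1" "(x, y) \<notin> hole a b" "canon a b (x, y) \<noteq> (a, b)"
    by auto
  then show thesis
  proof (cases rule: canon_cases[of x y])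
    case off
    with z u show thesis by (intro that(3))
  qed (use that(1,2) z c a0 b0 in auto)
qed

end

section \<open>Continuous functions that detect corners and gluings\<close>

lemma abs_sin_diff_int: "\<bar>sin (pi * (x - of_int n))\<bar> = \<bar>sin (pi * x)\<bar>"
  by (simp add: right_diff_distrib sin_diff)

text \<open>A continuous stand-in for the position of \<open>frac x\<close> relative to
  \<open>c\<close>: both factors change sign together under an odd shift, and for
  \<open>0 < c < 1\<close> the product is zero at 0 and \<open>c\<close>, negative between them and
  positive beyond \<open>c\<close>.\<close>

definition edge_fn :: "real \<Rightarrow> real \<Rightarrow> real" where
  "edge_fn c x = sin (pi * x) * sin (pi * (x - c))"

lemma edge_fn_frac: "edge_fn c (frac x) = edge_fn c x"
proof -
  have *: "sin (pi * (x - of_int n)) = (if even n then sin (pi * x) else - sin (pi * x))" for x and n :: int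
    by (simp add: right_diff_distrib sin_diff)
  from *[of x "\<lfloor>x\<rfloor>"] *[of "x - c" "\<lfloor>x\<rfloor>"]
  show ?thesis unfolding edge_fn_def frac_def
    by (auto simp: algebra_simps split: if_splits)
qed

lemma edge_fn_unit:
  assumes "0 < c" "c < 1" "0 \<le> x" "x < 1"
  shows "edge_fn c x = 0 \<longleftrightarrow> x = 0 \<or> x = c" "edge_fn c x > 0 \<longleftrightarrow> c < x"
proof -
  consider "x = 0" | "0 < x" "x < c" | "x = c" | "c < x" using assms by linarith
  then have "(edge_fn c x = 0 \<longleftrightarrow> x = 0 \<or> x = c) \<and> (edge_fn c x > 0 \<longleftrightarrow> c < x)"
  proof cases
    case 2
    then have "sin (pi * x) > 0" "sin (pi * (c - x)) > 0"
      using assms by (auto intro!: sin_gt_zero simp: mult_less_cancel_left1)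
    moreover have "sin (pi * (x - c)) = - sin (pi * (c - x))"
      by (metis minus_diff_eq mult_minus_right sin_minus)
    ultimately have "edge_fn c x < 0" by (auto simp: edge_fn_def intro: mult_pos_pos)
    then show ?thesis using 2 by auto
  next
    case 4
    then have "sin (pi * x) > 0" "sin (pi * (x - c)) > 0"
      using assms by (auto intro!: sin_gt_zero simp: mult_less_cancel_left1)
    then show ?thesis using 4 assms by (auto simp: edge_fn_def)
  qed (use assms in \<open>auto simp: edge_fn_def\<close>)
  then show "edge_fn c x = 0 \<longleftrightarrow> x = 0 \<or> x = c" "edge_fn c x > 0 \<longleftrightarrow> c < x" by auto
qed

lemma abs_sin_eq_0_unit:
  assumes "0 \<le> x" "x < 1" "0 \<le> x'" "x' < 1"
  shows "\<bar>sin (pi * (x - x'))\<bar> = 0 \<longleftrightarrow> x = x'"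
proof -
  have "sin (pi * t) > 0" if "0 < t" "t < 1" for t
    using that by (auto intro!: sin_gt_zero simp: mult_less_cancel_left1)
  from this[of "x - x'"] this[of "x' - x"] show ?thesis
    using assms by (auto simp: sin_diff algebra_simps) (smt (verit, best) linorder_less_linear)
qed

text \<open>Continuous, invariant under the gluings, and zero exactly at the corners of the holes.\<close>
definition corner_fn :: "real \<Rightarrow> real \<Rightarrow> real \<times> real \<Rightarrow> real" where
  "corner_fn a b p = \<bar>edge_fn a (fst p)\<bar> + \<bar>edge_fn b (snd p)\<bar>"

text \<open>Continuous, and zero exactly on the pairs of plane points that are glued to each other
  (see \<open>glue_dist_eq_0_iff\<close>); this is how the surface is seen to be Hausdorff.\<close>
definition glue_dist :: "real \<Rightarrow> real \<Rightarrow> real \<times> real \<Rightarrow> real \<times> real \<Rightarrow> real" where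
  "glue_dist a b p q =
     min \<bar>sin (pi * (fst p - fst q))\<bar>
       (\<bar>edge_fn a (fst p)\<bar> + \<bar>edge_fn a (fst q)\<bar> + max 0 (edge_fn b (snd p)) + max 0 (edge_fn b (snd q))) +
     min \<bar>sin (pi * (snd p - snd q))\<bar>
       (\<bar>edge_fn b (snd p)\<bar> + \<bar>edge_fn b (snd q)\<bar> + max 0 (edge_fn a (fst p)) + max 0 (edge_fn a (fst q)))"

lemma glue_dist_frac:
  "glue_dist a b (frac x, frac y) (frac x', frac y') = glue_dist a b (x, y) (x', y')"
proof -
  have *: "\<bar>sin (pi * (frac x - frac x'))\<bar> = \<bar>sin (pi * (x - x'))\<bar>" for x x' :: real
    using abs_sin_diff_int[of "x - x'" "\<lfloor>x\<rfloor> - \<lfloor>x'\<rfloor>"] by (simp add: frac_def algebra_simps)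
  show ?thesis by (simp only: glue_dist_def fst_conv snd_conv edge_fn_frac *)
qed

context holed_torus
begin

lemma corner_fn_canon: "corner_fn a b (canon a b p) = corner_fn a b p"
proof -
  have "edge_fn c 0 = 0" "edge_fn c c = 0" for c by (auto simp: edge_fn_def)
  then have "corner_fn a b (canon a b p) = corner_fn a b (frac (fst p), frac (snd p))"
    by (auto simp: canon_def corner_fn_def Let_def)
  then show ?thesis by (simp add: corner_fn_def edge_fn_frac)
qed

lemma corner_fn_pos:
  assumes "regpt a b z"
  shows "corner_fn a b z > 0"
proof -
  have "edge_fn a (fst z) \<noteq> 0 \<or> edge_fn b (snd z) \<noteq> 0"
    using assms
  proof (cases rule: regpt_cases)
    case (vert y)
    then show ?thesis using edge_fn_unit(1)[of b y] b0 b1 by auto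
  next
    case (horiz x)
    then show ?thesis using edge_fn_unit(1)[of a x] a0 a1 by auto
  next
    case (off x y)
    then show ?thesis
      using edge_fn_unit(1)[of a x] a0 a1 edge_fn_unit(1)[of b y] b0 b1 by auto
  qed
  then show ?thesis unfolding corner_fn_def by (smt (verit) abs_ge_zero zero_less_abs_iff)
qed

lemma corner_fn_zero: "corner_fn a b (a, b) = 0"
  by (simp add: corner_fn_def edge_fn_def)

lemma canon_neq_zero: "corner_fn a b p > 0 \<Longrightarrow> canon a b p \<noteq> (a, b)"
  by (metis corner_fn_canon corner_fn_zero less_irrefl)

lemma isCont_corner_fn: "isCont (corner_fn a b) p"
  unfolding corner_fn_def edge_fn_def by (intro continuous_intros)

text \<open>Both summands are nonnegative, so both minima have to vanish. \<open>A = 0\<close> says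
  that both points lie on vertical sides of holes, where the x-coordinates may differ;
  \<open>B = 0\<close> says the same for horizontal sides. The resulting four cases are exactly the
  identifications made by \<open>canon\<close>, the case \<open>A = B = 0\<close> being the
  corners.\<close>

lemma glue_dist_eq_0_iff:
  "glue_dist a b p q = 0 \<longleftrightarrow> canon a b p = canon a b q"
  if "p \<notin> hole a b" "q \<notin> hole a b"
proof -
  obtain x0 y0 x0' y0' where pq: "p = (x0, y0)" "q = (x0', y0')" by force
  define x y x' y' where xy: "x = frac x0" "y = frac y0" "x' = frac x0'" "y' = frac y0'"
  have u: "0 \<le> x" "x < 1" "0 \<le> y" "y < 1" and u': "0 \<le> x'" "x' < 1" "0 \<le> y'" "y' < 1"
    by (auto simp: xy frac_lt_1)
  have h: "\<not> (0 < x \<and> x < a \<and> 0 < y \<and> y < b)" "\<not> (0 < x' \<and> x' < a \<and> 0 < y' \<and> y' < b)"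
    using that by (auto simp: hole_def pq xy)
  define A where "A = \<bar>edge_fn a x\<bar> + \<bar>edge_fn a x'\<bar> + max 0 (edge_fn b y) + max 0 (edge_fn b y')"
  define B where "B = \<bar>edge_fn b y\<bar> + \<bar>edge_fn b y'\<bar> + max 0 (edge_fn a x) + max 0 (edge_fn a x')"
  have AB: "A \<ge> 0" "B \<ge> 0" by (auto simp: A_def B_def)
  have A0: "A = 0 \<longleftrightarrow> edge_fn a x = 0 \<and> edge_fn a x' = 0 \<and> \<not> edge_fn b y > 0 \<and> \<not> edge_fn b y' > 0"
    unfolding A_def by (auto simp: max_def abs_if)
  have B0: "B = 0 \<longleftrightarrow> edge_fn b y = 0 \<and> edge_fn b y' = 0 \<and> \<not> edge_fn a x > 0 \<and> \<not> edge_fn a x' > 0"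
    unfolding B_def by (auto simp: max_def abs_if)
  have A1: "A = 0 \<longleftrightarrow> (x = 0 \<or> x = a) \<and> (x' = 0 \<or> x' = a) \<and> y \<le> b \<and> y' \<le> b"
    unfolding A0 edge_fn_unit[OF a0 a1 u(1,2)] edge_fn_unit[OF a0 a1 u'(1,2)]
      edge_fn_unit[OF b0 b1 u(3,4)] edge_fn_unit[OF b0 b1 u'(3,4)] by auto
  have B1: "B = 0 \<longleftrightarrow> (y = 0 \<or> y = b) \<and> (y' = 0 \<or> y' = b) \<and> x \<le> a \<and> x' \<le> a"
    unfolding B0 edge_fn_unit[OF a0 a1 u(1,2)] edge_fn_unit[OF a0 a1 u'(1,2)]
      edge_fn_unit[OF b0 b1 u(3,4)] edge_fn_unit[OF b0 b1 u'(3,4)] by auto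
  have "glue_dist a b p q = min \<bar>sin (pi * (x - x'))\<bar> A + min \<bar>sin (pi * (y - y'))\<bar> B"
    unfolding pq glue_dist_frac[symmetric, of a b x0] by (simp add: glue_dist_def A_def B_def xy)
  then have "glue_dist a b p q = 0 \<longleftrightarrow>
      (\<bar>sin (pi * (x - x'))\<bar> = 0 \<or> A = 0) \<and> (\<bar>sin (pi * (y - y'))\<bar> = 0 \<or> B = 0)"
    using AB by (smt (verit) abs_ge_zero)
  also have "\<dots> \<longleftrightarrow> (x = x' \<or> A = 0) \<and> (y = y' \<or> B = 0)"
    using abs_sin_eq_0_unit[OF u(1,2) u'(1,2)] abs_sin_eq_0_unit[OF u(3,4) u'(3,4)] by simp
  also have "\<dots> \<longleftrightarrow> canon a b (x, y) = canon a b (x', y')"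
    unfolding A1 B1 canon_of_unit[OF u] canon_of_unit[OF u']
    using h u u' a0 b0 by (smt (verit) prod.inject)
  also have "\<dots> \<longleftrightarrow> canon a b p = canon a b q"
    by (simp add: xy pq canon_frac)
  finally show ?thesis .
qed

end

section \<open>Germs of the exponential map\<close>

lemma isCont_imp_tendsto_nhds: "isCont f x \<Longrightarrow> (f \<longlongrightarrow> f x) (nhds x)"
  by (simp only: isCont_def tendsto_at_iff_tendsto_nhds)

context holed_torus
begin

lemma rep_mem: "rep a b z v \<in> {z, (0, snd z), (fst z, 0)}"
  by (auto simp: rep_def)

lemma rep_lift:
  assumes "regpt a b z"
  shows "canon a b (rep a b z v) = z" "rep a b z v \<notin> hole a b"
proof -
  have z: "canon a b z = z" "z \<notin> hole a b" using assms surf_iff by (auto simp: regpt_def)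
  from assms have "canon a b (rep a b z v) = z \<and> rep a b z v \<notin> hole a b"
  proof (cases rule: regpt_cases)
    case (vert y)
    then show ?thesis using z b1 a0 by (auto simp: rep_def canon_of_unit hole_of_unit)
  next
    case (horiz x)
    then show ?thesis using z a1 b0 by (auto simp: rep_def canon_of_unit hole_of_unit)
  next
    case (off x y)
    then show ?thesis using z by (auto simp: rep_def)
  qed
  then show "canon a b (rep a b z v) = z" "rep a b z v \<notin> hole a b" by auto
qed

lemma corner_fn_rep: "regpt a b z \<Longrightarrow> corner_fn a b (rep a b z v) = corner_fn a b z"
  by (metis corner_fn_canon rep_lift(1))

text \<open>From the right side a leftward displacement would enter the hole; from the left side,
  which \<open>rep\<close> chooses instead, it enters the gap between two holes, and the bound
  \<open>1 - a\<close> keeps it from the next hole. Horizontal sides are alike, with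
  \<open>1 - b\<close>.\<close>

lemma rep_add_notin_hole:
  assumes "regpt a b z"
  shows "\<forall>\<^sub>F v in nhds 0. rep a b z v + v \<notin> hole a b"
  using assms
proof (cases rule: regpt_cases)
  case (vert y)
  have "min (1 - a) (min y (b - y)) > 0" using vert a1 by auto
  from eventually_abs_less[OF this] show ?thesis
  proof eventually_elim
    case (elim v)
    obtain s t where v: "v = (s, t)" by force
    have "a \<le> frac s" if "s < 0" using frac_neg_unit[of s] that elim a0 by (auto simp: v)
    moreover have "a \<le> frac (a + s)" if "s \<ge> 0" using frac_unit[of "a + s"] that elim a0 by (auto simp: v)
    ultimately show ?case using vert elim by (auto simp: rep_def v hole_def not_less)
  qed
next
  case (horiz x)
  have "min (1 - b) (min x (a - x)) > 0" using horiz b1 by auto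
  from eventually_abs_less[OF this] show ?thesis
  proof eventually_elim
    case (elim v)
    obtain s t where v: "v = (s, t)" by force
    have "b \<le> frac t" if "t < 0" using frac_neg_unit[of t] that elim b0 by (auto simp: v)
    moreover have "b \<le> frac (b + t)" if "t \<ge> 0" using frac_unit[of "b + t"] that elim b0 by (auto simp: v)
    ultimately show ?case using horiz elim by (auto simp: rep_def v hole_def not_less)
  qed
next
  case (off x y)
  then consider "x > a" | "y > b" by auto
  then show ?thesis
  proof cases
    case 1
    have "min (1 - x) (x - a) > 0" using 1 off by auto
    from eventually_abs_less[OF this] show ?thesis
    proof eventually_elim
      case (elim v)
      obtain s t where v: "v = (s, t)" by force
      have "frac (x + s) = x + s" using elim a0 by (intro frac_unit) (auto simp: v)
      then show ?case using 1 off elim by (auto simp: rep_def v hole_def)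
    qed
  next
    case 2
    have "min (1 - y) (y - b) > 0" using 2 off by auto
    from eventually_abs_less[OF this] show ?thesis
    proof eventually_elim
      case (elim v)
      obtain s t where v: "v = (s, t)" by force
      have "frac (y + t) = y + t" using elim b0 by (intro frac_unit) (auto simp: v)
      then show ?case using 2 off elim by (auto simp: rep_def v hole_def)
    qed
  qed
qed

text \<open>As a map into the plane \<open>expo a b z\<close> may jump, because \<open>canon\<close>
  chooses representatives. After composition with the \<open>canon\<close>-invariant
  \<open>corner_fn\<close> the jumps disappear: \<open>rep\<close> has at most three values, and at
  those that occur \<open>corner_fn\<close> has the same value as at \<open>z\<close>.\<close>

lemma tendsto_corner_fn_expo:
  assumes "regpt a b z"
  shows "((\<lambda>v. corner_fn a b (expo a b z v)) \<longlongrightarrow> corner_fn a b z) (nhds 0)"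
proof (rule tendstoI)
  fix e :: real assume "e > 0"
  have 1: "\<forall>\<^sub>F v in nhds 0. dist (corner_fn a b (q + v)) (corner_fn a b q) < e" for q
  proof -
    have "isCont (\<lambda>v. corner_fn a b (q + v)) 0"
      using isCont_o2[of 0 "\<lambda>v. q + v" "corner_fn a b"] isCont_corner_fn by auto
    then have "((\<lambda>v. corner_fn a b (q + v)) \<longlongrightarrow> corner_fn a b q) (nhds 0)"
      using isCont_imp_tendsto_nhds by fastforce
    with \<open>e > 0\<close> show ?thesis by (simp add: tendsto_iff)
  qed
  from 1[of z] 1[of "(0, snd z)"] 1[of "(fst z, 0)"]
  show "\<forall>\<^sub>F v in nhds 0. dist (corner_fn a b (expo a b z v)) (corner_fn a b z) < e"
  proof eventually_elim
    case (elim v)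
    show ?case using rep_mem[of z v] elim corner_fn_rep[OF assms, of v]
      by (auto simp: expo_def corner_fn_canon)
  qed
qed

lemma regpt_canon: "q \<notin> hole a b \<Longrightarrow> corner_fn a b q > 0 \<Longrightarrow> regpt a b (canon a b q)"
  using canon_neq_zero by (auto simp: regpt_def surf_def)

lemma regpt_expo:
  assumes "regpt a b z"
  shows "\<forall>\<^sub>F v in nhds 0. regpt a b (expo a b z v)"
proof -
  have "\<forall>\<^sub>F v in nhds 0. corner_fn a b (expo a b z v) > 0"
    using order_tendstoD(1)[OF tendsto_corner_fn_expo[OF assms] corner_fn_pos[OF assms]] .
  with rep_add_notin_hole[OF assms] show ?thesis
    by eventually_elim (auto simp: expo_def corner_fn_canon intro: regpt_canon)
qed

lemma expo_0: "regpt a b z \<Longrightarrow> expo a b z 0 = z"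
  by (simp add: expo_def rep_lift)

text \<open>This is the Hausdorff property. Lifts of distinct points have nonzero
  \<open>glue_dist\<close>, which remains nonzero under small displacements; only nine pairs of
  candidates for lifts arise, so one neighbourhood of 0 serves all of them.\<close>

lemma expo_inj:
  assumes "regpt a b z" "regpt a b z'" "z \<noteq> z'"
  shows "\<forall>\<^sub>F v in nhds 0. expo a b z v \<noteq> expo a b z' v"
proof -
  \<comment> \<open>Being a lift is a premise here, since not each of the three candidates for
    \<open>rep\<close> need be a lift of the point.\<close>
  have 1: "\<forall>\<^sub>F v in nhds 0. q \<notin> hole a b \<longrightarrow> q' \<notin> hole a b \<longrightarrow> canon a b q = z \<longrightarrow> canon a b q' = z' \<longrightarrow>
     q + v \<notin> hole a b \<longrightarrow> q' + v \<notin> hole a b \<longrightarrow> canon a b (q + v) \<noteq> canon a b (q' + v)" for q q'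
  proof (cases "q \<notin> hole a b \<and> q' \<notin> hole a b \<and> canon a b q = z \<and> canon a b q' = z'")
    case True
    then have "glue_dist a b q q' \<noteq> 0" using glue_dist_eq_0_iff[of q q'] assms(3) by auto
    moreover have "isCont (\<lambda>v. glue_dist a b (q + v) (q' + v)) 0"
      unfolding glue_dist_def edge_fn_def by (intro continuous_intros)
    then have "((\<lambda>v. glue_dist a b (q + v) (q' + v)) \<longlongrightarrow> glue_dist a b q q') (nhds 0)"
      using isCont_imp_tendsto_nhds by fastforce
    ultimately have "\<forall>\<^sub>F v in nhds 0. glue_dist a b (q + v) (q' + v) \<noteq> 0"
      using tendsto_imp_eventually_ne by blast
    then show ?thesis by eventually_elim (use glue_dist_eq_0_iff in blast)
  qed (auto intro: always_eventually)
  have "\<forall>\<^sub>F v in nhds 0. \<forall>q \<in> {z, (0, snd z), (fst z, 0)}. \<forall>q' \<in> {z', (0, snd z'), (fst z', 0)}.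
     q \<notin> hole a b \<longrightarrow> q' \<notin> hole a b \<longrightarrow> canon a b q = z \<longrightarrow> canon a b q' = z' \<longrightarrow>
     q + v \<notin> hole a b \<longrightarrow> q' + v \<notin> hole a b \<longrightarrow> canon a b (q + v) \<noteq> canon a b (q' + v)"
    by (intro eventually_ball_finite ballI 1) auto
  with rep_add_notin_hole[OF assms(1)] rep_add_notin_hole[OF assms(2)] show ?thesis
  proof eventually_elim
    case (elim v)
    show ?case unfolding expo_def
      using elim(3)[rule_format, OF rep_mem rep_mem] elim(1,2) rep_lift[OF assms(1)] rep_lift[OF assms(2)]
      by blast
  qed
qed

lemma eventually_fst_neg_iff: "s \<noteq> 0 \<Longrightarrow> \<forall>\<^sub>F w in nhds (0::real \<times> real). (s + fst w < 0) = (s < 0)"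
  using eventually_abs_less[of "\<bar>s\<bar>"] by (auto elim!: eventually_mono)

lemma eventually_snd_neg_iff: "s \<noteq> 0 \<Longrightarrow> \<forall>\<^sub>F w in nhds (0::real \<times> real). (s + snd w < 0) = (s < 0)"
  using eventually_abs_less[of "\<bar>s\<bar>"] by (auto elim!: eventually_mono)

text \<open>The lift chosen for \<open>v + w\<close> must serve for \<open>v\<close> too. If
  \<open>v\<close> leaves the side transversally, a small \<open>w\<close> does not change the
  choice. If \<open>v\<close> runs along the side, either lift may be chosen, and both lead to the
  same point as long as \<open>v\<close> stops short of the corner; hence the bounds
  \<open>min y (b - y)\<close> and \<open>min x (a - x)\<close>.\<close>

lemma rep_shift:
  assumes "regpt a b z"
  shows "\<exists>\<rho>>0. \<forall>v. \<bar>fst v\<bar> < \<rho> \<longrightarrow> \<bar>snd v\<bar> < \<rho> \<longrightarrow> rep a b z v + v \<notin> hole a b \<longrightarrow>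
     (\<forall>\<^sub>F w in nhds 0. canon a b (rep a b z (v + w) + v) = expo a b z v \<and> rep a b z (v + w) + v \<notin> hole a b)"
  using assms
proof (cases rule: regpt_cases)
  case (vert y)
  show ?thesis
  proof (intro exI[of _ "min y (b - y)"] conjI allI impI)
    fix v assume v: "\<bar>fst v\<bar> < min y (b - y)" "\<bar>snd v\<bar> < min y (b - y)" "rep a b z v + v \<notin> hole a b"
    show "\<forall>\<^sub>F w in nhds 0. canon a b (rep a b z (v + w) + v) = expo a b z v \<and> rep a b z (v + w) + v \<notin> hole a b"
    proof (cases "fst v = 0")
      case True
      then obtain t where t: "v = (0, t)" by (cases v) auto
      have "0 < y + t" "y + t < b" using v by (auto simp: t)
      then show ?thesis using a0 a1 b1
        by (intro always_eventually) (auto simp: expo_def rep_def vert t canon_of_unit hole_of_unit)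
    next
      case False
      from eventually_fst_neg_iff[OF this] show ?thesis
        by eventually_elim (use v(3) in \<open>auto simp: expo_def rep_def vert\<close>)
    qed
  qed (use vert in auto)
next
  case (horiz x)
  show ?thesis
  proof (intro exI[of _ "min x (a - x)"] conjI allI impI)
    fix v assume v: "\<bar>fst v\<bar> < min x (a - x)" "\<bar>snd v\<bar> < min x (a - x)" "rep a b z v + v \<notin> hole a b"
    show "\<forall>\<^sub>F w in nhds 0. canon a b (rep a b z (v + w) + v) = expo a b z v \<and> rep a b z (v + w) + v \<notin> hole a b"
    proof (cases "snd v = 0")
      case True
      then obtain t where t: "v = (t, 0)" by (cases v) auto
      have "0 < x + t" "x + t < a" using v by (auto simp: t)
      then show ?thesis using b0 b1 a1
        by (intro always_eventually) (auto simp: expo_def rep_def horiz t canon_of_unit hole_of_unit)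
    next
      case False
      from eventually_snd_neg_iff[OF this] show ?thesis
        by eventually_elim (use v(3) in \<open>auto simp: expo_def rep_def horiz\<close>)
    qed
  qed (use horiz in auto)
next
  case (off x y)
  then have "rep a b z v = z" for v by (auto simp: rep_def)
  then show ?thesis by (intro exI[of _ 1]) (simp add: expo_def)
qed

lemma eventually_nhds_0_shift:
  assumes "\<forall>\<^sub>F v in nhds (0::real \<times> real). P v"
  obtains \<delta> where "\<delta> > 0" "\<And>v. \<bar>fst v\<bar> < \<delta> \<Longrightarrow> \<bar>snd v\<bar> < \<delta> \<Longrightarrow> P v"
    "\<And>v. \<bar>fst v\<bar> < \<delta> \<Longrightarrow> \<bar>snd v\<bar> < \<delta> \<Longrightarrow> \<forall>\<^sub>F w in nhds 0. P (v + w)"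
proof -
  obtain d where d: "d > 0" "\<And>v. \<bar>fst v\<bar> < d \<Longrightarrow> \<bar>snd v\<bar> < d \<Longrightarrow> P v"
    using assms unfolding eventually_nhds_0_prod_iff by auto
  have "\<forall>\<^sub>F w in nhds 0. P (v + w)" if "\<bar>fst v\<bar> < d" "\<bar>snd v\<bar> < d" for v
  proof -
    have "0 < min (d - \<bar>fst v\<bar>) (d - \<bar>snd v\<bar>)" using that by auto
    from eventually_abs_less[OF this] show ?thesis
      by eventually_elim (intro d(2); auto)
  qed
  with d show thesis by (intro that) auto
qed

text \<open>The lift used for \<open>v + w\<close>, moved by \<open>v\<close>, is a lift of
  \<open>expo a b z v\<close>, so \<open>expo_canon\<close> applies at it. Having this for all
  \<open>v\<close> in a square allows lines to be followed inside one germ.\<close>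

lemma expo_add:
  assumes "regpt a b z"
  obtains \<rho> where "\<rho> > 0"
    "\<And>v. \<bar>fst v\<bar> < \<rho> \<Longrightarrow> \<bar>snd v\<bar> < \<rho> \<Longrightarrow> regpt a b (expo a b z v)"
    "\<And>v. \<bar>fst v\<bar> < \<rho> \<Longrightarrow> \<bar>snd v\<bar> < \<rho> \<Longrightarrow>
       \<forall>\<^sub>F w in nhds 0. expo a b (expo a b z v) w = expo a b z (v + w)"
proof -
  obtain d1 where d1: "d1 > 0" "\<And>v. \<bar>fst v\<bar> < d1 \<Longrightarrow> \<bar>snd v\<bar> < d1 \<Longrightarrow> rep a b z v + v \<notin> hole a b \<Longrightarrow>
      (\<forall>\<^sub>F w in nhds 0. canon a b (rep a b z (v + w) + v) = expo a b z v \<and> rep a b z (v + w) + v \<notin> hole a b)"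
    using rep_shift[OF assms] by blast
  obtain d2 where d2: "d2 > 0"
    "\<And>v. \<bar>fst v\<bar> < d2 \<Longrightarrow> \<bar>snd v\<bar> < d2 \<Longrightarrow> rep a b z v + v \<notin> hole a b"
    "\<And>v. \<bar>fst v\<bar> < d2 \<Longrightarrow> \<bar>snd v\<bar> < d2 \<Longrightarrow> \<forall>\<^sub>F w in nhds 0. rep a b z (v + w) + (v + w) \<notin> hole a b"
    using eventually_nhds_0_shift[OF rep_add_notin_hole[OF assms]] by blast
  obtain d3 where d3: "d3 > 0"
    "\<And>v. \<bar>fst v\<bar> < d3 \<Longrightarrow> \<bar>snd v\<bar> < d3 \<Longrightarrow> regpt a b (expo a b z v)"
    using regpt_expo[OF assms] unfolding eventually_nhds_0_prod_iff by auto
  show thesis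
  proof (rule that[of "min d1 (min d2 d3)"])
    fix v assume v: "\<bar>fst v\<bar> < min d1 (min d2 d3)" "\<bar>snd v\<bar> < min d1 (min d2 d3)"
    have reg: "regpt a b (expo a b z v)" using d3 v by auto
    have "\<forall>\<^sub>F w in nhds 0. q + v \<notin> hole a b \<longrightarrow> canon a b (q + v) = expo a b z v \<longrightarrow>
        (q + v) + w \<notin> hole a b \<longrightarrow> canon a b ((q + v) + w) = expo a b (expo a b z v) w" for q
    proof (cases "q + v \<notin> hole a b \<and> canon a b (q + v) = expo a b z v")
      case True
      then show ?thesis using expo_canon[of "q + v"] reg by (auto simp: regpt_def)
    qed (auto intro: always_eventually)
    then have "\<forall>\<^sub>F w in nhds 0. \<forall>q \<in> {z, (0, snd z), (fst z, 0)}. q + v \<notin> hole a b \<longrightarrow>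
        canon a b (q + v) = expo a b z v \<longrightarrow>
        (q + v) + w \<notin> hole a b \<longrightarrow> canon a b ((q + v) + w) = expo a b (expo a b z v) w"
      by (intro eventually_ball_finite ballI) auto
    moreover have "\<forall>\<^sub>F w in nhds 0. canon a b (rep a b z (v + w) + v) = expo a b z v \<and> rep a b z (v + w) + v \<notin> hole a b"
      using d1(2) d2(2) v by auto
    moreover have "\<forall>\<^sub>F w in nhds 0. rep a b z (v + w) + (v + w) \<notin> hole a b"
      using d2(3) v by auto
    ultimately show "\<forall>\<^sub>F w in nhds 0. expo a b (expo a b z v) w = expo a b z (v + w)"
    proof eventually_elim
      case (elim w)
      then have "canon a b ((rep a b z (v + w) + v) + w) = expo a b (expo a b z v) w"
        using rep_mem[of z "v + w"] by (auto simp: add.assoc simp del: add_Pair)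
      then show ?case by (simp add: expo_def[of a b z "v + w"] add.assoc)
    qed
  qed (use d1 d2 d3 in auto)
qed

end

section \<open>Straight lines, strips and unique continuation\<close>

text \<open>The two lifts in \<open>flow_line\<close>, one for the past and one for the future, are
  absorbed into \<open>expo\<close>; a geodesic becomes a single local equation.\<close>

definition line :: "real \<Rightarrow> real \<Rightarrow> real \<times> real \<Rightarrow> (real \<Rightarrow> real \<times> real) \<Rightarrow> real set \<Rightarrow> bool" where
  "line a b u g I \<longleftrightarrow> (\<forall>t\<in>I. regpt a b (g t) \<and>
     (\<exists>\<delta>>0. \<forall>s\<in>I. \<bar>s - t\<bar> < \<delta> \<longrightarrow> g s = expo a b (g t) ((s - t) *\<^sub>R u)))"

text \<open>\<open>\<Phi>\<close> is a translation chart of the strip of height \<open>h\<close> in direction \<open>u\<close>.\<close>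
definition strip_iso :: "real \<Rightarrow> real \<Rightarrow> real \<times> real \<Rightarrow> real \<Rightarrow> (real \<Rightarrow> real \<Rightarrow> real \<times> real) \<Rightarrow> bool" where
  "strip_iso a b u h \<Phi> \<longleftrightarrow> (\<forall>t r. 0 < r \<longrightarrow> r < h \<longrightarrow> regpt a b (\<Phi> t r) \<and>
     (\<forall>\<^sub>F v in nhds 0. \<Phi> (t + fst v) (r + snd v) = expo a b (\<Phi> t r) (fst v *\<^sub>R u + snd v *\<^sub>R perp u)))"

lemma mv_eq: "mv q c u = q + c *\<^sub>R u"
  by (simp add: mv_def prod_eq_iff)

lemma eventually_nhds_0_scaleR:
  fixes u :: "'a::real_normed_vector"
  assumes "\<forall>\<^sub>F v in nhds 0. P v"
  shows "\<exists>\<delta>>0. \<forall>c. \<bar>c\<bar> < \<delta> \<longrightarrow> P (c *\<^sub>R u)"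
proof -
  have "((\<lambda>c. c *\<^sub>R u) \<longlongrightarrow> 0 *\<^sub>R u) (nhds 0)"
    by (rule isCont_imp_tendsto_nhds) (intro continuous_intros)
  then have "\<forall>\<^sub>F c in nhds (0::real). P (c *\<^sub>R u)"
    using assms by (simp add: filterlim_iff)
  then show ?thesis by (simp add: eventually_nhds_metric)
qed

lemma rep_scaleR: "c > 0 \<Longrightarrow> rep a b z (c *\<^sub>R u) = rep a b z u"
  by (simp add: rep_def mult_less_0_iff)

context holed_torus
begin

text \<open>The points \<open>q1\<close> and \<open>q2\<close> are lifts of \<open>g t\<close>, so
  \<open>expo_canon\<close> turns both halves into the equation of \<open>line\<close>. Conversely
  \<open>rep\<close> is constant on each open ray, and its values at \<open>- u\<close> and
  \<open>u\<close> serve as \<open>q1\<close> and \<open>q2\<close>.\<close>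

lemma flow_line_iff_line: "flow_line a b u g I \<longleftrightarrow> line a b u g I"
proof
  assume fl: "flow_line a b u g I"
  show "line a b u g I"
    unfolding line_def
  proof (intro ballI)
    fix t assume t: "t \<in> I"
    from fl t obtain d q1 q2 where d: "d > 0" and nz: "g t \<noteq> (a, b)"
      and q1: "\<And>s. s \<in> I \<Longrightarrow> t - d < s \<Longrightarrow> s \<le> t \<Longrightarrow>
         q1 + (s - t) *\<^sub>R u \<notin> hole a b \<and> canon a b (q1 + (s - t) *\<^sub>R u) = g s"
      and q2: "\<And>s. s \<in> I \<Longrightarrow> t \<le> s \<Longrightarrow> s < t + d \<Longrightarrow>
         q2 + (s - t) *\<^sub>R u \<notin> hole a b \<and> canon a b (q2 + (s - t) *\<^sub>R u) = g s"
      unfolding flow_line_def mv_eq zero_pt_def by metis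
    have c: "q1 \<notin> hole a b" "canon a b q1 = g t" "q2 \<notin> hole a b" "canon a b q2 = g t"
      using q1[of t] q2[of t] t d by auto
    have reg: "regpt a b (g t)"
      using c nz unfolding regpt_def surf_def by (metis ComplI imageI)
    obtain d1 where d1: "d1 > 0" "\<And>c. \<bar>c\<bar> < d1 \<Longrightarrow> q1 + c *\<^sub>R u \<notin> hole a b \<Longrightarrow>
        canon a b (q1 + c *\<^sub>R u) = expo a b (g t) (c *\<^sub>R u)"
      using eventually_nhds_0_scaleR[OF expo_canon[OF c(1)]] c nz by metis
    obtain d2 where d2: "d2 > 0" "\<And>c. \<bar>c\<bar> < d2 \<Longrightarrow> q2 + c *\<^sub>R u \<notin> hole a b \<Longrightarrow>
        canon a b (q2 + c *\<^sub>R u) = expo a b (g t) (c *\<^sub>R u)"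
      using eventually_nhds_0_scaleR[OF expo_canon[OF c(3)]] c nz by metis
    show "regpt a b (g t) \<and> (\<exists>\<delta>>0. \<forall>s\<in>I. \<bar>s - t\<bar> < \<delta> \<longrightarrow> g s = expo a b (g t) ((s - t) *\<^sub>R u))"
    proof (intro conjI reg exI[of _ "min d (min d1 d2)"] ballI impI)
      fix s assume s: "s \<in> I" "\<bar>s - t\<bar> < min d (min d1 d2)"
      show "g s = expo a b (g t) ((s - t) *\<^sub>R u)"
      proof (cases "s \<le> t")
        case True
        then show ?thesis using q1[of s] d1(2)[of "s - t"] s by auto
      next
        case False
        then show ?thesis using q2[of s] d2(2)[of "s - t"] s by auto
      qed
    qed (use d d1 d2 in auto)
  qed
next
  assume ln: "line a b u g I"
  show "flow_line a b u g I"
    unfolding flow_line_def mv_eq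
  proof (intro ballI conjI)
    fix t assume t: "t \<in> I"
    from ln t obtain d where d: "d > 0" and reg: "regpt a b (g t)"
      and g: "\<And>s. s \<in> I \<Longrightarrow> \<bar>s - t\<bar> < d \<Longrightarrow> g s = expo a b (g t) ((s - t) *\<^sub>R u)"
      unfolding line_def by metis
    show "g t \<noteq> zero_pt a b" using reg by (simp add: regpt_def zero_pt_def)
    obtain d1 where d1: "d1 > 0" "\<And>c. \<bar>c\<bar> < d1 \<Longrightarrow> rep a b (g t) (c *\<^sub>R u) + c *\<^sub>R u \<notin> hole a b"
      using eventually_nhds_0_scaleR[OF rep_add_notin_hole[OF reg]] by metis
    have neg: "rep a b (g t) (c *\<^sub>R u) = rep a b (g t) (- u)" if "c < 0" for c
      using rep_scaleR[of "- c" a b "g t" "- u"] that by simp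
    have P: "rep a b (g t) (sgn c *\<^sub>R u) + c *\<^sub>R u \<notin> hole a b \<and>
        canon a b (rep a b (g t) (sgn c *\<^sub>R u) + c *\<^sub>R u) = expo a b (g t) (c *\<^sub>R u)"
      if "\<bar>c\<bar> < d1" for c
    proof -
      have "rep a b (g t) (c *\<^sub>R u) = rep a b (g t) (sgn c *\<^sub>R u)"
        using rep_scaleR[of c a b "g t" u] neg[of c] by (cases c "0::real" rule: linorder_cases) auto
      then show ?thesis using d1(2)[OF that] by (simp add: expo_def)
    qed
    have l: "rep a b (g t) v \<notin> hole a b" "canon a b (rep a b (g t) v) = g t" for v
      using rep_lift[OF reg] by auto
    show "\<exists>\<delta>>0. \<exists>q1 q2.
         (\<forall>s\<in>I. t - \<delta> < s \<and> s \<le> t \<longrightarrow> q1 + (s - t) *\<^sub>R u \<notin> hole a b \<and> canon a b (q1 + (s - t) *\<^sub>R u) = g s) \<and>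
         (\<forall>s\<in>I. t \<le> s \<and> s < t + \<delta> \<longrightarrow> q2 + (s - t) *\<^sub>R u \<notin> hole a b \<and> canon a b (q2 + (s - t) *\<^sub>R u) = g s)"
    proof (rule exI[of _ "min d d1"], rule conjI, use d d1 in simp, rule exI[of _ "rep a b (g t) (- u)"],
        rule exI[of _ "rep a b (g t) u"], intro conjI ballI impI; elim conjE)
      fix s assume s: "s \<in> I" "t - min d d1 < s" "s \<le> t"
      show "rep a b (g t) (- u) + (s - t) *\<^sub>R u \<notin> hole a b"
        using P[of "s - t"] s l by (cases "s = t") auto
      show "canon a b (rep a b (g t) (- u) + (s - t) *\<^sub>R u) = g s"
        using P[of "s - t"] s l g[of s] by (cases "s = t") auto
    next
      fix s assume s: "s \<in> I" "t \<le> s" "s < t + min d d1"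
      show "rep a b (g t) u + (s - t) *\<^sub>R u \<notin> hole a b"
        using P[of "s - t"] s l by (cases "s = t") auto
      show "canon a b (rep a b (g t) u + (s - t) *\<^sub>R u) = g s"
        using P[of "s - t"] s l g[of s] by (cases "s = t") auto
    qed
  qed
qed

text \<open>Agreement is locally constant: where two lines agree they share the germ given by
  \<open>expo\<close>, and where they differ \<open>expo_inj\<close> keeps them apart
  nearby.\<close>

lemma line_unique:
  assumes "line a b u g I" "line a b u g' I" "connected I" "t0 \<in> I" "g t0 = g' t0" "t \<in> I"
  shows "g t = g' t"
proof (rule connected_induction_simple[OF assms(3), where P = "\<lambda>t. g t = g' t" and a = t0 and b = t])
  fix x assume x: "x \<in> I"
  from assms(1) x obtain d where d: "d > 0" "regpt a b (g x)"
    "\<And>s. s \<in> I \<Longrightarrow> \<bar>s - x\<bar> < d \<Longrightarrow> g s = expo a b (g x) ((s - x) *\<^sub>R u)"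
    unfolding line_def by metis
  from assms(2) x obtain d' where d': "d' > 0" "regpt a b (g' x)"
    "\<And>s. s \<in> I \<Longrightarrow> \<bar>s - x\<bar> < d' \<Longrightarrow> g' s = expo a b (g' x) ((s - x) *\<^sub>R u)"
    unfolding line_def by metis
  have "\<exists>e>0. g x \<noteq> g' x \<longrightarrow> (\<forall>c. \<bar>c\<bar> < e \<longrightarrow> expo a b (g x) (c *\<^sub>R u) \<noteq> expo a b (g' x) (c *\<^sub>R u))"
    using eventually_nhds_0_scaleR[OF expo_inj[OF d(2) d'(2)], of u] zero_less_one by metis
  then obtain e where e: "e > 0"
    "\<And>c. g x \<noteq> g' x \<Longrightarrow> \<bar>c\<bar> < e \<Longrightarrow> expo a b (g x) (c *\<^sub>R u) \<noteq> expo a b (g' x) (c *\<^sub>R u)"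
    by metis
  have eq: "g s = g' s \<longleftrightarrow> g x = g' x" if "s \<in> I" "\<bar>s - x\<bar> < min d (min d' e)" for s
  proof -
    have "\<bar>s - x\<bar> < d" "\<bar>s - x\<bar> < d'" "\<bar>s - x\<bar> < e" using that(2) by auto
    with d(3)[OF that(1)] d'(3)[OF that(1)] e(2)[of "s - x"] show ?thesis by metis
  qed
  show "\<exists>T. openin (top_of_set I) T \<and> x \<in> T \<and> (\<forall>x\<in>T. \<forall>y\<in>T. g x = g' x \<longrightarrow> g y = g' y)"
  proof (intro exI[of _ "I \<inter> ball x (min d (min d' e))"] conjI ballI impI)
    show "openin (top_of_set I) (I \<inter> ball x (min d (min d' e)))"
      by (rule openin_open_Int[OF open_ball])
    show "x \<in> I \<inter> ball x (min d (min d' e))" using x d(1) d'(1) e(1) by simp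
  next
    fix s s' assume "s \<in> I \<inter> ball x (min d (min d' e))" "s' \<in> I \<inter> ball x (min d (min d' e))" "g s = g' s"
    then show "g s' = g' s'" using eq[of s] eq[of s'] by (simp add: dist_real_def abs_minus_commute)
  qed
qed (use assms in auto)

lemma line_subset: "line a b u g I \<Longrightarrow> J \<subseteq> I \<Longrightarrow> line a b u g J"
  unfolding line_def by (meson subsetD)

text \<open>Oblique directions are included because the core of one cylinder has to be followed
  inside another whose direction is not yet known to be the same.\<close>

lemma strip_iso_line:
  assumes "strip_iso a b u h \<Phi>"
  shows "line a b (\<alpha> *\<^sub>R u + \<beta> *\<^sub>R perp u) (\<lambda>s. \<Phi> (t0 + \<alpha> * s) (r0 + \<beta> * s)) {s. 0 < r0 + \<beta> * s \<and> r0 + \<beta> * s < h}"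
  unfolding line_def
proof (intro ballI)
  fix s assume s: "s \<in> {s. 0 < r0 + \<beta> * s \<and> r0 + \<beta> * s < h}"
  then have reg: "regpt a b (\<Phi> (t0 + \<alpha> * s) (r0 + \<beta> * s))"
    and ev: "\<forall>\<^sub>F v in nhds 0. \<Phi> (t0 + \<alpha> * s + fst v) (r0 + \<beta> * s + snd v) =
      expo a b (\<Phi> (t0 + \<alpha> * s) (r0 + \<beta> * s)) (fst v *\<^sub>R u + snd v *\<^sub>R perp u)"
    using assms unfolding strip_iso_def by auto
  obtain d where d: "d > 0" "\<And>c. \<bar>c\<bar> < d \<Longrightarrow> \<Phi> (t0 + \<alpha> * s + c * \<alpha>) (r0 + \<beta> * s + c * \<beta>) =
      expo a b (\<Phi> (t0 + \<alpha> * s) (r0 + \<beta> * s)) ((c * \<alpha>) *\<^sub>R u + (c * \<beta>) *\<^sub>R perp u)"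
    using eventually_nhds_0_scaleR[OF ev, of "(\<alpha>, \<beta>)"] by auto
  show "regpt a b (\<Phi> (t0 + \<alpha> * s) (r0 + \<beta> * s)) \<and> (\<exists>\<delta>>0. \<forall>s'\<in>{s. 0 < r0 + \<beta> * s \<and> r0 + \<beta> * s < h}. \<bar>s' - s\<bar> < \<delta> \<longrightarrow>
      \<Phi> (t0 + \<alpha> * s') (r0 + \<beta> * s') =
      expo a b (\<Phi> (t0 + \<alpha> * s) (r0 + \<beta> * s)) ((s' - s) *\<^sub>R (\<alpha> *\<^sub>R u + \<beta> *\<^sub>R perp u)))"
  proof (intro conjI reg exI[of _ d] ballI impI)
    fix s' assume "\<bar>s' - s\<bar> < d"
    from d(2)[OF this] show "\<Phi> (t0 + \<alpha> * s') (r0 + \<beta> * s') =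
      expo a b (\<Phi> (t0 + \<alpha> * s) (r0 + \<beta> * s)) ((s' - s) *\<^sub>R (\<alpha> *\<^sub>R u + \<beta> *\<^sub>R perp u))"
      by (simp add: algebra_simps)
  qed (use d in auto)
qed

lemma expo_line:
  assumes "\<rho> > 0"
    "\<And>v. \<bar>fst v\<bar> < \<rho> \<Longrightarrow> \<bar>snd v\<bar> < \<rho> \<Longrightarrow> regpt a b (expo a b z v)"
    "\<And>v. \<bar>fst v\<bar> < \<rho> \<Longrightarrow> \<bar>snd v\<bar> < \<rho> \<Longrightarrow>
       \<forall>\<^sub>F w in nhds 0. expo a b (expo a b z v) w = expo a b z (v + w)"
  shows "line a b u (\<lambda>s. expo a b z (v + (s - s0) *\<^sub>R u))
     {s. \<bar>fst v + (s - s0) * fst u\<bar> < \<rho> \<and> \<bar>snd v + (s - s0) * snd u\<bar> < \<rho>}"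
  unfolding line_def
proof (intro ballI)
  fix t assume t: "t \<in> {s. \<bar>fst v + (s - s0) * fst u\<bar> < \<rho> \<and> \<bar>snd v + (s - s0) * snd u\<bar> < \<rho>}"
  have "\<bar>fst (v + (t - s0) *\<^sub>R u)\<bar> < \<rho>" "\<bar>snd (v + (t - s0) *\<^sub>R u)\<bar> < \<rho>" using t by auto
  from eventually_nhds_0_scaleR[OF assms(3)[OF this]]
  obtain d where d: "d > 0" "\<And>c. \<bar>c\<bar> < d \<Longrightarrow> expo a b (expo a b z (v + (t - s0) *\<^sub>R u)) (c *\<^sub>R u) =
      expo a b z (v + (t - s0) *\<^sub>R u + c *\<^sub>R u)"
    by metis
  show "regpt a b (expo a b z (v + (t - s0) *\<^sub>R u)) \<and>
     (\<exists>\<delta>>0. \<forall>s\<in>{s. \<bar>fst v + (s - s0) * fst u\<bar> < \<rho> \<and> \<bar>snd v + (s - s0) * snd u\<bar> < \<rho>}. \<bar>s - t\<bar> < \<delta> \<longrightarrow>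
       expo a b z (v + (s - s0) *\<^sub>R u) = expo a b (expo a b z (v + (t - s0) *\<^sub>R u)) ((s - t) *\<^sub>R u))"
  proof (intro conjI exI[of _ d] ballI impI)
    show "regpt a b (expo a b z (v + (t - s0) *\<^sub>R u))" using t by (intro assms(2)) auto
    fix s assume "\<bar>s - t\<bar> < d"
    from d(2)[OF this] show "expo a b z (v + (s - s0) *\<^sub>R u) = expo a b (expo a b z (v + (t - s0) *\<^sub>R u)) ((s - t) *\<^sub>R u)"
      by (simp add: algebra_simps)
  qed (use d in auto)
qed

text \<open>\<open>is_cyl\<close> constrains rows and columns separately, not their joint behaviour.
  Near a point, the column through it and then the rows that cross this column are compared with
  lines in the germ \<open>expo a b z\<close> by unique continuation.\<close>

lemma is_cyl_strip_iso:
  assumes "is_cyl a b u w h \<Phi>"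
  shows "strip_iso a b u h \<Phi>"
  unfolding strip_iso_def
proof (intro allI impI)
  fix t0 r0 assume r0: "0 < r0" "r0 < h"
  have row: "line a b u (\<lambda>t. \<Phi> t r) UNIV" if "0 < r" "r < h" for r
    using assms that by (auto simp: is_cyl_def flow_line_iff_line)
  have col: "line a b (perp u) (\<lambda>r. \<Phi> t r) {0<..<h}" for t
    using assms by (auto simp: is_cyl_def flow_line_iff_line)
  have u: "\<bar>fst u\<bar> \<le> 1" "\<bar>snd u\<bar> \<le> 1"
  proof -
    have "(fst u)\<^sup>2 + (snd u)\<^sup>2 = 1" using assms by (simp add: is_cyl_def)
    then have "(fst u)\<^sup>2 \<le> 1" "(snd u)\<^sup>2 \<le> 1" using zero_le_power2[of "fst u"] zero_le_power2[of "snd u"] by linarith+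
    then show "\<bar>fst u\<bar> \<le> 1" "\<bar>snd u\<bar> \<le> 1" by (auto simp: abs_square_le_1)
  qed
  define z where "z = \<Phi> t0 r0"
  have reg: "regpt a b z" using row[OF r0] unfolding line_def z_def by blast
  obtain \<rho> where \<rho>: "\<rho> > 0"
    "\<And>v. \<bar>fst v\<bar> < \<rho> \<Longrightarrow> \<bar>snd v\<bar> < \<rho> \<Longrightarrow> regpt a b (expo a b z v)"
    "\<And>v. \<bar>fst v\<bar> < \<rho> \<Longrightarrow> \<bar>snd v\<bar> < \<rho> \<Longrightarrow>
       \<forall>\<^sub>F w in nhds 0. expo a b (expo a b z v) w = expo a b z (v + w)"
    using expo_add[OF reg] by blast
  \<comment> \<open>Half of \<rho>, as moving by less than \<open>e\<close> along \<open>u\<close>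
    and along \<open>perp u\<close> changes each coordinate by less than \<open>2 * e\<close>. The
    other bounds keep the rows inside the strip.\<close>
  define e where "e = min (\<rho> / 2) (min r0 (h - r0))"
  have e: "e > 0" "e \<le> \<rho> / 2" "e \<le> r0" "e \<le> h - r0" using \<rho>(1) r0 unfolding e_def by (simp_all add: min_def)
  have mb: "\<bar>c * x\<bar> < e" if "\<bar>c\<bar> < e" "\<bar>x\<bar> \<le> 1" for c x :: real
    using that mult_left_le[of "\<bar>x\<bar>" "\<bar>c\<bar>"] by (simp add: abs_mult)
  have 1: "\<Phi> t0 r = expo a b z ((r - r0) *\<^sub>R perp u)" if "\<bar>r - r0\<bar> < e" for r
  proof (rule line_unique[where u = "perp u" and g = "\<Phi> t0" and
        g' = "\<lambda>r. expo a b z ((r - r0) *\<^sub>R perp u)" and I = "{r0 - e<..<r0 + e}" and ?t0.0 = r0 and t = r])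
    show "line a b (perp u) (\<Phi> t0) {r0 - e<..<r0 + e}"
      by (rule line_subset[OF col]) (use e(3,4) in auto)
    show "line a b (perp u) (\<lambda>r. expo a b z ((r - r0) *\<^sub>R perp u)) {r0 - e<..<r0 + e}"
    proof (rule line_subset)
      show "line a b (perp u) (\<lambda>r. expo a b z ((r - r0) *\<^sub>R perp u))
         {s. \<bar>fst 0 + (s - r0) * fst (perp u)\<bar> < \<rho> \<and> \<bar>snd 0 + (s - r0) * snd (perp u)\<bar> < \<rho>}"
        using expo_line[OF \<rho>, of "perp u" 0 r0] by simp
      show "{r0 - e<..<r0 + e} \<subseteq> {s. \<bar>fst 0 + (s - r0) * fst (perp u)\<bar> < \<rho> \<and> \<bar>snd 0 + (s - r0) * snd (perp u)\<bar> < \<rho>}"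
      proof
        fix s assume "s \<in> {r0 - e<..<r0 + e}"
        then have "\<bar>s - r0\<bar> < e" by auto
        then show "s \<in> {s. \<bar>fst 0 + (s - r0) * fst (perp u)\<bar> < \<rho> \<and> \<bar>snd 0 + (s - r0) * snd (perp u)\<bar> < \<rho>}"
          using mb[of "s - r0" "fst u"] mb[of "s - r0" "- snd u"] u e \<rho>(1) by (auto simp: perp_def)
      qed
    qed
  qed (use that e expo_0[OF reg] in \<open>auto simp: z_def\<close>)
  have 2: "\<Phi> t r = expo a b z ((t - t0) *\<^sub>R u + (r - r0) *\<^sub>R perp u)" if r: "\<bar>r - r0\<bar> < e" and t: "\<bar>t - t0\<bar> < e" for t r
  proof (rule line_unique[where u = u and g = "\<lambda>t. \<Phi> t r" and
        g' = "\<lambda>t. expo a b z ((t - t0) *\<^sub>R u + (r - r0) *\<^sub>R perp u)" and I = "{t0 - e<..<t0 + e}" and ?t0.0 = t0 and t = t])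
    show "line a b u (\<lambda>t. \<Phi> t r) {t0 - e<..<t0 + e}"
      by (rule line_subset[OF row]) (use e(3,4) r in auto)
    show "line a b u (\<lambda>t. expo a b z ((t - t0) *\<^sub>R u + (r - r0) *\<^sub>R perp u)) {t0 - e<..<t0 + e}"
    proof (rule line_subset)
      let ?v = "(r - r0) *\<^sub>R perp u"
      show "line a b u (\<lambda>t. expo a b z ((t - t0) *\<^sub>R u + (r - r0) *\<^sub>R perp u))
         {s. \<bar>fst ?v + (s - t0) * fst u\<bar> < \<rho> \<and> \<bar>snd ?v + (s - t0) * snd u\<bar> < \<rho>}"
        using expo_line[OF \<rho>, of u ?v t0] by (simp add: add.commute)
      show "{t0 - e<..<t0 + e} \<subseteq> {s. \<bar>fst ?v + (s - t0) * fst u\<bar> < \<rho> \<and> \<bar>snd ?v + (s - t0) * snd u\<bar> < \<rho>}"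
      proof
        fix s assume "s \<in> {t0 - e<..<t0 + e}"
        then have "\<bar>s - t0\<bar> < e" by auto
        from mb[OF this u(1)] mb[OF this u(2)] mb[OF r, of "- snd u"] mb[OF r, of "fst u"] u e
        show "s \<in> {s. \<bar>fst ?v + (s - t0) * fst u\<bar> < \<rho> \<and> \<bar>snd ?v + (s - t0) * snd u\<bar> < \<rho>}"
          by (auto simp: perp_def)
      qed
    qed
  qed (use that e 1[OF r] in auto)
  have "\<forall>\<^sub>F v in nhds 0. \<Phi> (t0 + fst v) (r0 + snd v) = expo a b z (fst v *\<^sub>R u + snd v *\<^sub>R perp u)"
    using eventually_abs_less[OF e(1)] by eventually_elim (use 2 in auto)
  with reg show "regpt a b (\<Phi> t0 r0) \<and>
    (\<forall>\<^sub>F v in nhds 0. \<Phi> (t0 + fst v) (r0 + snd v) = expo a b (\<Phi> t0 r0) (fst v *\<^sub>R u + snd v *\<^sub>R perp u))"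
    by (simp add: z_def)
qed

end

section \<open>Maximality of cylinders\<close>

lemma periodic_of_int:
  fixes f :: "real \<Rightarrow> 'a"
  assumes "\<And>t. f (t + w) = f t"
  shows "f (t + of_int n * w) = f t"
proof (induction n rule: int_induct[where k = 0])
  case (step1 i)
  then show ?case using assms[of "t + of_int i * w"] by (simp add: algebra_simps)
next
  case (step2 i)
  then show ?case using assms[of "t + of_int (i - 1) * w"] by (simp add: algebra_simps)
qed simp

lemma perp_lincomb: "perp (\<alpha> *\<^sub>R u + \<beta> *\<^sub>R perp u) = \<alpha> *\<^sub>R perp u - \<beta> *\<^sub>R u"
  by (simp add: perp_def prod_eq_iff)

lemma perp_basis:
  assumes "(fst u)\<^sup>2 + (snd u)\<^sup>2 = 1"
  shows "u' = (fst u' * fst u + snd u' * snd u) *\<^sub>R u + (snd u' * fst u - fst u' * snd u) *\<^sub>R perp u"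
proof -
  have "(fst u' * fst u + snd u' * snd u) * fst u - (snd u' * fst u - fst u' * snd u) * snd u
      = fst u' * ((fst u)\<^sup>2 + (snd u)\<^sup>2)"
    "(fst u' * fst u + snd u' * snd u) * snd u + (snd u' * fst u - fst u' * snd u) * fst u
      = snd u' * ((fst u)\<^sup>2 + (snd u)\<^sup>2)"
    by algebra+
  with assms show ?thesis by (simp add: perp_def prod_eq_iff)
qed

lemma is_cyl_inj_snd:
  assumes "is_cyl a b u w h \<Phi>" "\<Phi> t r = \<Phi> t' r'" "0 < r" "r < h" "0 < r'" "r' < h"
  shows "r = r'"
proof -
  have w: "w > 0" using assms by (simp add: is_cyl_def)
  have *: "\<exists>s\<in>{0..<w}. \<Phi> s r = \<Phi> t r" if "0 < r" "r < h" for t r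
  proof -
    have "\<Phi> (t + w) r = \<Phi> t r" for t using assms(1) that by (simp add: is_cyl_def)
    from periodic_of_int[of "\<lambda>t. \<Phi> t r" w t "- \<lfloor>t / w\<rfloor>", OF this]
    have "\<Phi> (t - of_int \<lfloor>t / w\<rfloor> * w) r = \<Phi> t r" by simp
    moreover have "t - of_int \<lfloor>t / w\<rfloor> * w \<in> {0..<w}"
      using w floor_divide_lower[OF w, of t] floor_divide_upper[OF w, of t] by (auto simp: algebra_simps)
    ultimately show ?thesis by blast
  qed
  obtain s s' where s: "s \<in> {0..<w}" "\<Phi> s r = \<Phi> t r" "s' \<in> {0..<w}" "\<Phi> s' r' = \<Phi> t' r'"
    using *[OF assms(3,4)] *[OF assms(5,6)] by metis
  have "inj_on (\<lambda>(t, r). \<Phi> t r) ({0..<w} \<times> {0<..<h})" using assms by (simp add: is_cyl_def)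
  from inj_onD[OF this, of "(s, r)" "(s', r')"] show ?thesis using s assms by auto
qed

context holed_torus
begin

text \<open>The chart of the larger cylinder follows the core only while the affine height stays
  inside. With \<beta> \<noteq> 0 this ends at a finite time \<open>S\<close>. But the core point at
  time \<open>S\<close> also lies in the larger cylinder, at an interior height \<open>r1\<close>;
  restarting the chart there and comparing heights shortly before \<open>S\<close> makes
  \<open>r1\<close> a boundary height.\<close>

lemma strip_iso_image_parallel:
  assumes u: "(fst u)\<^sup>2 + (snd u)\<^sup>2 = 1" and h: "0 < h" and iso: "strip_iso a b u h \<Phi>"
    and cyl: "is_cyl a b u' w' h' \<Phi>'" and sub: "cyl_image h \<Phi> \<subseteq> cyl_image h' \<Phi>'"
  obtains \<alpha> where "\<alpha> = 1 \<or> \<alpha> = -1" "u = \<alpha> *\<^sub>R u'"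
proof -
  define \<alpha> where "\<alpha> = fst u * fst u' + snd u * snd u'"
  define \<beta> where "\<beta> = snd u * fst u' - fst u * snd u'"
  have u': "(fst u')\<^sup>2 + (snd u')\<^sup>2 = 1" using cyl by (simp add: is_cyl_def)
  have uab: "u = \<alpha> *\<^sub>R u' + \<beta> *\<^sub>R perp u'"
    unfolding \<alpha>_def \<beta>_def by (rule perp_basis[OF u'])
  have "\<alpha>\<^sup>2 + \<beta>\<^sup>2 = ((fst u)\<^sup>2 + (snd u)\<^sup>2) * ((fst u')\<^sup>2 + (snd u')\<^sup>2)"
    unfolding \<alpha>_def \<beta>_def by algebra
  then have ab1: "\<alpha>\<^sup>2 + \<beta>\<^sup>2 = 1" using u u' by simp
  have iso': "strip_iso a b u' h' \<Phi>'" using is_cyl_strip_iso[OF cyl] .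
  have mem: "\<exists>t' r'. 0 < r' \<and> r' < h' \<and> \<Phi> t r = \<Phi>' t' r'" if "0 < r" "r < h" for t r
    using sub that unfolding cyl_image_def by blast
  obtain t0 r0 where z0: "0 < r0" "r0 < h'" "\<Phi> 0 (h/2) = \<Phi>' t0 r0" using mem[of "h/2" 0] h by auto
  have core: "line a b u (\<lambda>s. \<Phi> s (h/2)) UNIV"
    using strip_iso_line[OF iso, of 1 0 0 "h/2"] h by simp
  have line': "line a b u (\<lambda>s. \<Phi>' (t + \<alpha> * s) (r + \<beta> * s)) {s. 0 < r + \<beta> * s \<and> r + \<beta> * s < h'}" for t r
    using strip_iso_line[OF iso', of \<alpha> \<beta> t r] uab by simp
  have "\<beta> = 0"
  proof (rule ccontr)
    assume b: "\<beta> \<noteq> 0"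
    \<comment> \<open>The time at which the height reaches the end of the interval from 0 to
      \<open>h'\<close> towards which it moves.\<close>
    define S where "S = (if \<beta> > 0 then (h' - r0) / \<beta> else - r0 / \<beta>)"
    have S0: "S > 0" using b z0 unfolding S_def by (auto simp: divide_pos_neg)
    have SS: "r0 + \<beta> * S = 0 \<or> r0 + \<beta> * S = h'" using b by (auto simp: S_def)
    have in1: "0 < r0 + \<beta> * s \<and> r0 + \<beta> * s < h'" if "0 \<le> s" "s < S" for s
    proof (cases "\<beta> > 0")
      case True
      then have "\<beta> * s < h' - r0" using that by (simp add: S_def pos_less_divide_eq mult.commute)
      then show ?thesis using True that z0 by (auto simp: add_pos_nonneg)
    next
      case False
      with b have "\<beta> < 0" by simp
      then have "\<beta> * (- r0 / \<beta>) < \<beta> * s"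
        using that mult_strict_left_mono_neg[of s "- r0 / \<beta>" \<beta>] by (simp add: S_def)
      then have "- r0 < \<beta> * s" using b by simp
      moreover have "\<beta> * s \<le> 0" using \<open>\<beta> < 0\<close> that by (simp add: mult_nonpos_nonneg)
      ultimately show ?thesis using z0 by auto
    qed
    have eq1: "\<Phi> s (h/2) = \<Phi>' (t0 + \<alpha> * s) (r0 + \<beta> * s)" if "0 \<le> s" "s < S" for s
    proof (rule line_unique[where u = u and g = "\<lambda>s. \<Phi> s (h/2)" and
          g' = "\<lambda>s. \<Phi>' (t0 + \<alpha> * s) (r0 + \<beta> * s)" and I = "{0..<S}" and ?t0.0 = 0 and t = s])
      show "line a b u (\<lambda>s. \<Phi> s (h/2)) {0..<S}" by (rule line_subset[OF core]) auto
      show "line a b u (\<lambda>s. \<Phi>' (t0 + \<alpha> * s) (r0 + \<beta> * s)) {0..<S}"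
        by (rule line_subset[OF line']) (use in1 in auto)
    qed (use S0 z0 that in auto)
    obtain t1 r1 where z1: "0 < r1" "r1 < h'" "\<Phi> S (h/2) = \<Phi>' t1 r1" using mem[of "h/2" S] h by auto
    have line1: "line a b u (\<lambda>s. \<Phi>' ((t1 - \<alpha> * S) + \<alpha> * s) ((r1 - \<beta> * S) + \<beta> * s))
        {s. 0 < (r1 - \<beta> * S) + \<beta> * s \<and> (r1 - \<beta> * S) + \<beta> * s < h'}"
      by (rule line')
    define m where "m = min r1 (h' - r1) / \<bar>\<beta>\<bar>"
    have m0: "m > 0" using z1 b by (auto simp: m_def)
    have in2: "0 < (r1 - \<beta> * S) + \<beta> * s \<and> (r1 - \<beta> * S) + \<beta> * s < h'" if "\<bar>s - S\<bar> < m" for s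
    proof -
      have "\<bar>\<beta>\<bar> * \<bar>s - S\<bar> < min r1 (h' - r1)" using that b by (simp add: m_def pos_less_divide_eq mult.commute)
      then have "\<bar>\<beta> * (s - S)\<bar> < min r1 (h' - r1)" by (simp add: abs_mult)
      then show ?thesis unfolding right_diff_distrib by linarith
    qed
    have eq2: "\<Phi> s (h/2) = \<Phi>' ((t1 - \<alpha> * S) + \<alpha> * s) ((r1 - \<beta> * S) + \<beta> * s)" if "\<bar>s - S\<bar> < m" for s
    proof (rule line_unique[where u = u and g = "\<lambda>s. \<Phi> s (h/2)" and
          g' = "\<lambda>s. \<Phi>' ((t1 - \<alpha> * S) + \<alpha> * s) ((r1 - \<beta> * S) + \<beta> * s)" and I = "{S - m<..<S + m}" and ?t0.0 = S and t = s])
      show "line a b u (\<lambda>s. \<Phi> s (h/2)) {S - m<..<S + m}" by (rule line_subset[OF core]) auto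
      show "line a b u (\<lambda>s. \<Phi>' ((t1 - \<alpha> * S) + \<alpha> * s) ((r1 - \<beta> * S) + \<beta> * s)) {S - m<..<S + m}"
        by (rule line_subset[OF line1]) (use in2 in \<open>auto simp: abs_less_iff\<close>)
    qed (use m0 z1 that in auto)
    \<comment> \<open>A time before \<open>S\<close> at which both descriptions of the core are
      valid.\<close>
    define s where "s = S - min (S / 2) (m / 2)"
    have s: "0 \<le> s" "s < S" "\<bar>s - S\<bar> < m" using S0 m0 by (auto simp: s_def)
    have "\<Phi>' (t0 + \<alpha> * s) (r0 + \<beta> * s) = \<Phi>' ((t1 - \<alpha> * S) + \<alpha> * s) ((r1 - \<beta> * S) + \<beta> * s)"
      using eq1[OF s(1,2)] eq2[OF s(3)] by simp
    from is_cyl_inj_snd[OF cyl this] in1[OF s(1,2)] in2[OF s(3)]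
    have "r1 = r0 + \<beta> * S" by auto
    with SS z1 show False by auto
  qed
  with ab1 have "\<alpha> = 1 \<or> \<alpha> = -1" by (simp add: power2_eq_1_iff)
  then show thesis using that uab \<open>\<beta> = 0\<close> by auto
qed

text \<open>Points at the interior height \<open>A\<close> are nonsingular, and near one of them
  \<open>corner_fn\<close> exceeds half its positive value there, against \<open>touch\<close>. The
  sign \<alpha> allows the two strips to run in opposite directions.\<close>

lemma strip_iso_not_touching:
  assumes iso': "strip_iso a b u' h' \<Phi>'" and A: "0 < A" "A < h'" and \<alpha>: "\<bar>\<alpha>\<bar> = 1"
    and eq: "\<And>t r. 0 < r \<Longrightarrow> r < h \<Longrightarrow> 0 < A + \<alpha> * (r - R) \<Longrightarrow> A + \<alpha> * (r - R) < h' \<Longrightarrow>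
        \<Phi> t r = \<Phi>' (t0 + \<alpha> * t) (A + \<alpha> * (r - R))"
    and touch: "\<And>e. e > 0 \<Longrightarrow> \<exists>t r. \<bar>t - t1\<bar> < e \<and> \<bar>r - R\<bar> < e \<and> 0 < r \<and> r < h \<and> corner_fn a b (\<Phi> t r) < e"
  shows False
proof -
  define z where "z = \<Phi>' (t0 + \<alpha> * t1) A"
  have reg: "regpt a b z" and ev: "\<forall>\<^sub>F v in nhds 0. \<Phi>' (t0 + \<alpha> * t1 + fst v) (A + snd v) =
      expo a b z (fst v *\<^sub>R u' + snd v *\<^sub>R perp u')"
    using iso' A by (auto simp: strip_iso_def z_def)
  have "isCont (\<lambda>v. fst v *\<^sub>R u' + snd v *\<^sub>R perp u') (0::real \<times> real)"
    by (intro continuous_intros)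
  from isCont_imp_tendsto_nhds[OF this]
  have "((\<lambda>v::real \<times> real. fst v *\<^sub>R u' + snd v *\<^sub>R perp u') \<longlongrightarrow> 0) (nhds 0)" by simp
  note tend = this
  have "\<forall>\<^sub>F v in nhds 0. corner_fn a b (expo a b z v) > corner_fn a b z / 2"
    using corner_fn_pos[OF reg] by (intro order_tendstoD(1)[OF tendsto_corner_fn_expo[OF reg]]) auto
  from eventually_compose_filterlim[OF this tend]
  have "\<forall>\<^sub>F v::real \<times> real in nhds 0. corner_fn a b (expo a b z (fst v *\<^sub>R u' + snd v *\<^sub>R perp u')) > corner_fn a b z / 2"
    by simp
  with ev have "\<forall>\<^sub>F v in nhds 0. corner_fn a b (\<Phi>' (t0 + \<alpha> * t1 + fst v) (A + snd v)) > corner_fn a b z / 2"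
    by eventually_elim simp
  then obtain d where d: "d > 0" "\<And>v. \<bar>fst v\<bar> < d \<Longrightarrow> \<bar>snd v\<bar> < d \<Longrightarrow>
      corner_fn a b (\<Phi>' (t0 + \<alpha> * t1 + fst v) (A + snd v)) > corner_fn a b z / 2"
    unfolding eventually_nhds_0_prod_iff by auto
  define e where "e = min (min d (corner_fn a b z / 2)) (min A (h' - A))"
  have "e > 0" using d(1) corner_fn_pos[OF reg] A by (simp add: e_def)
  from touch[OF this] obtain t r where tr: "\<bar>t - t1\<bar> < e" "\<bar>r - R\<bar> < e" "0 < r" "r < h" "corner_fn a b (\<Phi> t r) < e"
    by blast
  have ab: "\<bar>\<alpha> * x\<bar> = \<bar>x\<bar>" for x using \<alpha> by (simp add: abs_mult)
  have r': "\<bar>\<alpha> * (r - R)\<bar> < e" using ab tr by simp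
  have t': "\<bar>\<alpha> * (t - t1)\<bar> < e" using ab tr by simp
  have "\<Phi> t r = \<Phi>' (t0 + \<alpha> * t) (A + \<alpha> * (r - R))"
    using r' by (intro eq tr(3,4)) (auto simp: e_def)
  also have "\<dots> = \<Phi>' (t0 + \<alpha> * t1 + fst (\<alpha> * (t - t1), \<alpha> * (r - R))) (A + snd (\<alpha> * (t - t1), \<alpha> * (r - R)))"
    by (simp add: algebra_simps)
  finally have "corner_fn a b (\<Phi> t r) > corner_fn a b z / 2"
    using d(2)[of "(\<alpha> * (t - t1), \<alpha> * (r - R))"] r' t' by (simp add: e_def)
  with tr(5) show False by (simp add: e_def)
qed

text \<open>The boundary is not part of the chart, so \<open>touch\<close> expresses a corner on it
  by interior points converging to a boundary parameter with \<open>corner_fn\<close> tending to 0.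
  One corner on each boundary component is enough.\<close>

lemma cylinderI:
  assumes u: "(fst u)\<^sup>2 + (snd u)\<^sup>2 = 1" and wh: "0 < w" "0 < h"
    and iso: "strip_iso a b u h \<Phi>"
    and per: "\<And>t r. 0 < r \<Longrightarrow> r < h \<Longrightarrow> \<Phi> (t + w) r = \<Phi> t r"
    and inj: "\<And>t r t' r'. 0 < r \<Longrightarrow> r < h \<Longrightarrow> 0 < r' \<Longrightarrow> r' < h \<Longrightarrow> \<Phi> t r = \<Phi> t' r' \<Longrightarrow>
       r = r' \<and> (\<exists>n::int. t' = t + of_int n * w)"
    and touch: "\<And>R. R = 0 \<or> R = h \<Longrightarrow> \<exists>t1. \<forall>e>0. \<exists>t r. \<bar>t - t1\<bar> < e \<and> \<bar>r - R\<bar> < e \<and> 0 < r \<and> r < h \<and>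
       corner_fn a b (\<Phi> t r) < e"
  shows "cylinder a b u w h \<Phi>"
  unfolding cylinder_def
proof (intro conjI notI)
  show "is_cyl a b u w h \<Phi>"
    unfolding is_cyl_def flow_line_iff_line
  proof (intro conjI allI impI ballI)
    show "inj_on (\<lambda>(t, r). \<Phi> t r) ({0..<w} \<times> {0<..<h})"
    proof (rule inj_onI, clarify)
      fix t r t' r' assume *: "t \<in> {0..<w}" "t' \<in> {0..<w}" "r \<in> {0<..<h}" "r' \<in> {0<..<h}" "\<Phi> t r = \<Phi> t' r'"
      with inj[of r r' t t'] obtain n :: int where n: "r = r'" "t' = t + of_int n * w" by auto
      have "0 \<le> t" "t < w" "0 \<le> t'" "t' < w" using * by auto
      with n(2) have "of_int n * w < 1 * w" "(-1) * w < of_int n * w" by linarith+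
      then have "real_of_int n < 1" "-1 < real_of_int n"
        using wh(1) mult_right_less_imp_less[of "of_int n" w 1] mult_right_less_imp_less[of "-1" w "of_int n"] by linarith+
      then have "n = 0" by linarith
      with n show "t = t' \<and> r = r'" by auto
    qed
    show "line a b u (\<lambda>t. \<Phi> t r) UNIV" if "r \<in> {0<..<h}" for r
      using strip_iso_line[OF iso, of 1 0 0 r] that by simp
    show "line a b (perp u) (\<Phi> t) {0<..<h}" for t
      using strip_iso_line[OF iso, of 0 1 t 0] by (simp add: greaterThanLessThan_eq lessThan_def greaterThan_def Collect_conj_eq)
  qed (use assms in auto)
next
  assume "\<exists>u' w' h' \<Phi>'. is_cyl a b u' w' h' \<Phi>' \<and> cyl_image h \<Phi> \<subset> cyl_image h' \<Phi>'"
  then obtain u' w' h' \<Phi>' where cyl: "is_cyl a b u' w' h' \<Phi>'" and sub: "cyl_image h \<Phi> \<subset> cyl_image h' \<Phi>'" by blast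
  obtain \<alpha> where \<alpha>: "\<alpha> = 1 \<or> \<alpha> = -1" "u = \<alpha> *\<^sub>R u'"
    using strip_iso_image_parallel[OF u wh(2) iso cyl] sub by blast
  have pu: "perp u = \<alpha> *\<^sub>R perp u'" using perp_lincomb[of \<alpha> u' 0] \<alpha>(2) by simp
  have iso': "strip_iso a b u' h' \<Phi>'" using is_cyl_strip_iso[OF cyl] .
  have "\<Phi> 0 (h/2) \<in> cyl_image h \<Phi>"
    unfolding cyl_image_def using wh(2) by (intro CollectI exI[of _ 0] exI[of _ "h/2"]) auto
  with sub have "\<Phi> 0 (h/2) \<in> cyl_image h' \<Phi>'" by blast
  then obtain t0 r0 where z0: "0 < r0" "r0 < h'" "\<Phi> 0 (h/2) = \<Phi>' t0 r0" unfolding cyl_image_def by auto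
  have core: "\<Phi> t (h/2) = \<Phi>' (t0 + \<alpha> * t) r0" for t
  proof (rule line_unique[where u = u and g = "\<lambda>s. \<Phi> s (h/2)" and
          g' = "\<lambda>s. \<Phi>' (t0 + \<alpha> * s) r0" and I = UNIV and ?t0.0 = 0 and t = t])
    show "line a b u (\<lambda>s. \<Phi> s (h/2)) UNIV"
      using strip_iso_line[OF iso, of 1 0 0 "h/2"] wh by simp
    show "line a b u (\<lambda>s. \<Phi>' (t0 + \<alpha> * s) r0) UNIV"
      using strip_iso_line[OF iso', of \<alpha> 0 t0 r0] z0 \<alpha>(2) by simp
  qed (use z0 in auto)
  \<comment> \<open>The identification along the core is continued along the columns, as far as both
    heights remain admissible.\<close>
  have eq: "\<Phi> t r = \<Phi>' (t0 + \<alpha> * t) ((r0 - \<alpha> * (h/2)) + \<alpha> * r)"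
    if "0 < r" "r < h" "0 < (r0 - \<alpha> * (h/2)) + \<alpha> * r" "(r0 - \<alpha> * (h/2)) + \<alpha> * r < h'" for t r
  proof (rule line_unique[where u = "perp u" and g = "\<Phi> t" and
          g' = "\<lambda>r. \<Phi>' (t0 + \<alpha> * t) ((r0 - \<alpha> * (h/2)) + \<alpha> * r)" and
          I = "{0<..<h} \<inter> {r. 0 < (r0 - \<alpha> * (h/2)) + \<alpha> * r \<and> (r0 - \<alpha> * (h/2)) + \<alpha> * r < h'}" and ?t0.0 = "h/2" and t = r])
    show "line a b (perp u) (\<Phi> t) ({0<..<h} \<inter> {r. 0 < (r0 - \<alpha> * (h/2)) + \<alpha> * r \<and> (r0 - \<alpha> * (h/2)) + \<alpha> * r < h'})"
      by (rule line_subset[of _ _ "{r. 0 < 0 + 1 * r \<and> 0 + 1 * r < h}"])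
        (use strip_iso_line[OF iso, of 0 1 t 0] in auto)
    show "line a b (perp u) (\<lambda>r. \<Phi>' (t0 + \<alpha> * t) ((r0 - \<alpha> * (h/2)) + \<alpha> * r))
        ({0<..<h} \<inter> {r. 0 < (r0 - \<alpha> * (h/2)) + \<alpha> * r \<and> (r0 - \<alpha> * (h/2)) + \<alpha> * r < h'})"
      by (rule line_subset[of _ _ "{r. 0 < (r0 - \<alpha> * (h/2)) + \<alpha> * r \<and> (r0 - \<alpha> * (h/2)) + \<alpha> * r < h'}"])
        (use strip_iso_line[OF iso', of 0 \<alpha> "t0 + \<alpha> * t" "r0 - \<alpha> * (h/2)"] pu in auto)
    show "connected ({0<..<h} \<inter> {r. 0 < (r0 - \<alpha> * (h/2)) + \<alpha> * r \<and> (r0 - \<alpha> * (h/2)) + \<alpha> * r < h'})"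
      by (rule is_interval_connected) (use \<alpha>(1) in \<open>auto simp: is_interval_1\<close>)
  qed (use that z0 wh core in auto)
  have "\<not> (0 < r0 + \<alpha> * (R - h/2) \<and> r0 + \<alpha> * (R - h/2) < h')" if R: "R = 0 \<or> R = h" for R
  proof
    assume A: "0 < r0 + \<alpha> * (R - h/2) \<and> r0 + \<alpha> * (R - h/2) < h'"
    from touch[OF R] obtain t1 where t1: "\<And>e. e > 0 \<Longrightarrow> \<exists>t r. \<bar>t - t1\<bar> < e \<and> \<bar>r - R\<bar> < e \<and> 0 < r \<and> r < h \<and>
       corner_fn a b (\<Phi> t r) < e" by blast
    show False
    proof (rule strip_iso_not_touching[OF iso', where A = "r0 + \<alpha> * (R - h/2)" and \<alpha> = \<alpha> and h = h and R = R and \<Phi> = \<Phi> and ?t0.0 = t0 and ?t1.0 = t1])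
      fix t r assume "0 < r" "r < h" "0 < r0 + \<alpha> * (R - h/2) + \<alpha> * (r - R)" "r0 + \<alpha> * (R - h/2) + \<alpha> * (r - R) < h'"
      then show "\<Phi> t r = \<Phi>' (t0 + \<alpha> * t) (r0 + \<alpha> * (R - h/2) + \<alpha> * (r - R))"
        using eq[of r t] by (simp add: algebra_simps)
    qed (use A \<alpha> t1 in auto)
  qed
  from this[of 0] this[of h] have out: "\<not> (0 < r0 - \<alpha> * (h/2) \<and> r0 - \<alpha> * (h/2) < h')"
    "\<not> (0 < r0 + \<alpha> * (h/2) \<and> r0 + \<alpha> * (h/2) < h')" by auto
  have "cyl_image h' \<Phi>' \<subseteq> cyl_image h \<Phi>"
  proof
    fix z assume "z \<in> cyl_image h' \<Phi>'"
    then obtain t r where z: "0 < r" "r < h'" "z = \<Phi>' t r" by (auto simp: cyl_image_def)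
    \<comment> \<open>The inverse change of height. Since \<open>r0\<close> lies between 0 and
      \<open>h'\<close> and the images of both boundary heights do not, it sends every height of the
      larger cylinder into the interval from 0 to \<open>h\<close>.\<close>
    define r' where "r' = h/2 + \<alpha> * (r - r0)"
    have "0 < r'" "r' < h" using \<alpha>(1) out z z0 wh(2) unfolding r'_def by auto
    moreover have "\<Phi> (\<alpha> * (t - t0)) r' = \<Phi>' (t0 + \<alpha> * (\<alpha> * (t - t0))) ((r0 - \<alpha> * (h/2)) + \<alpha> * r')"
      using \<alpha>(1) z by (intro eq \<open>0 < r'\<close> \<open>r' < h\<close>) (auto simp: r'_def)
    then have "\<Phi> (\<alpha> * (t - t0)) r' = z" using \<alpha>(1) z by (auto simp: r'_def)
    ultimately show "z \<in> cyl_image h \<Phi>" unfolding cyl_image_def by blast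
  qed
  with sub show False by blast
qed

end

section \<open>Charts off the hole and the horizontal cylinder\<close>

lemma frac_eq_close: "frac s = frac t \<Longrightarrow> \<bar>s - t\<bar> < 1 \<Longrightarrow> s = t" for s t :: real
proof -
  assume "frac s = frac t" "\<bar>s - t\<bar> < 1"
  then have d: "s - t = of_int (\<lfloor>s\<rfloor> - \<lfloor>t\<rfloor>)" by (simp add: frac_def)
  with \<open>\<bar>s - t\<bar> < 1\<close> have "\<bar>\<lfloor>s\<rfloor> - \<lfloor>t\<rfloor>\<bar> < 1" by linarith
  with d show "s = t" by simp
qed

context holed_torus
begin

text \<open>Off the closed holes no side is involved: \<open>canon\<close> is reduction modulo 1 and
  \<open>rep\<close> never changes the starting point.\<close>

definition off_hole :: "real \<times> real \<Rightarrow> bool" where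
  "off_hole q \<longleftrightarrow> a < frac (fst q) \<or> b < frac (snd q)"

lemma off_hole_canon:
  assumes "off_hole q"
  shows "canon a b q = (frac (fst q), frac (snd q))"
  using assms a0 b0 by (auto simp: off_hole_def canon_def Let_def)

lemma off_hole_regpt: "off_hole q \<Longrightarrow> regpt a b (canon a b q)"
  unfolding regpt_def surf_iff canon_idem
  using canon_notin_hole[of q] off_hole_canon[of q] by (auto simp: off_hole_def hole_def)

lemma off_hole_expo:
  assumes "off_hole q"
  shows "\<forall>\<^sub>F v in nhds 0. canon a b (q + v) = expo a b (canon a b q) v"
proof (intro always_eventually allI)
  fix v
  have "rep a b (canon a b q) v = canon a b q"
    using assms unfolding off_hole_canon[OF assms] by (auto simp: rep_def off_hole_def)
  then show "canon a b (q + v) = expo a b (canon a b q) v"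
    using canon_frac_add[of "fst q" "snd q" v] by (simp add: expo_def off_hole_canon[OF assms])
qed

text \<open>The open horizontal cylinder of circumference \<open>1 - a\<close> between the holes, unrolled.\<close>
definition wrapV :: "real \<times> real \<Rightarrow> real \<times> real" where
  "wrapV q = (a + (1 - a) * frac ((fst q - a) / (1 - a)), snd q)"

lemma wrapV_shift: "wrapV (x + of_int n * (1 - a), y) = wrapV (x, y)"
proof -
  have "(x + of_int n * (1 - a) - a) / (1 - a) = (x - a) / (1 - a) + of_int n"
    using a1 by (simp add: field_simps)
  then show ?thesis by (simp add: wrapV_def)
qed

lemma wrapV_unit: "a \<le> x \<Longrightarrow> x < 1 \<Longrightarrow> wrapV (x, y) = (x, y)"
  using a1 frac_unit[of "(x - a) / (1 - a)"] by (simp add: wrapV_def)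

lemma wrapV_reduce:
  obtains m n where "a \<le> m" "m < 1" "x = m + of_int n * (1 - a)" "wrapV (x, y) = (m, y)"
proof -
  define n where "n = \<lfloor>(x - a) / (1 - a)\<rfloor>"
  define m where "m = x - of_int n * (1 - a)"
  have a: "0 < 1 - a" using a1 by simp
  have m: "a \<le> m" "m < 1"
    using floor_divide_lower[OF a, of "x - a"] floor_divide_upper[OF a, of "x - a"]
    by (auto simp: m_def n_def algebra_simps)
  have x: "x = m + of_int n * (1 - a)" by (simp add: m_def)
  have "wrapV (x, y) = (m, y)" using wrapV_shift[of m n y] wrapV_unit[OF m, of y] unfolding x by simp
  from that[OF m x this] show thesis .
qed

lemma wrapV_regpt:
  assumes "0 < y" "y < b"
  shows "regpt a b (wrapV (x, y))"
proof -
  obtain m n where m: "a \<le> m" "m < 1" "wrapV (x, y) = (m, y)" using wrapV_reduce by metis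
  then show ?thesis unfolding m(3) regpt_def surf_iff using assms a0 b1
    by (auto simp: hole_of_unit canon_of_unit)
qed

text \<open>The wrap matters only at \<open>m = a\<close>. Moving left by \<open>s < 0\<close> from
  the right side of the hole means leaving the left side to the left, at \<open>s + 1\<close>
  instead of \<open>a + s\<close>; the two differ by exactly the period
  \<open>1 - a\<close>.\<close>

lemma wrapV_expo:
  assumes "0 < y" "y < b"
  shows "\<forall>\<^sub>F v in nhds 0. wrapV ((x, y) + v) = expo a b (wrapV (x, y)) v"
proof -
  obtain m n where m: "a \<le> m" "m < 1" "x = m + of_int n * (1 - a)" "wrapV (x, y) = (m, y)" using wrapV_reduce by metis
  have sh: "wrapV ((x, y) + v) = wrapV (m + fst v, y + snd v)" for v
    using wrapV_shift[of "m + fst v" n "y + snd v"] by (cases v) (simp add: m(3) algebra_simps)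
  have sh1: "wrapV (x, y) = wrapV (x + (1 - a), y)" for x y using wrapV_shift[of x 1 y] by simp
  show ?thesis
  proof (cases "m = a")
    case True
    have "min (min (1 - a) y) (b - y) > 0" using a1 assms by auto
    from eventually_abs_less[OF this] show ?thesis
    proof eventually_elim
      case (elim v)
      obtain s t where v: "v = (s, t)" by force
      show ?case
      proof (cases "s < 0")
        case True
        have "canon a b (s, y + t) = canon a b (s + of_int 1, y + t)" by (simp only: canon_def fst_conv snd_conv frac_add_of_int_right)
        also have "\<dots> = (s + 1, y + t)" using True elim a0 b1 assms by (subst canon_of_unit) (auto simp: v)
        finally show ?thesis unfolding sh unfolding m(4)
          using True elim a0 b1 assms \<open>m = a\<close> sh1[of "a + s" "y + t"] wrapV_unit[of "s + 1" "y + t"]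
          by (simp add: v expo_def rep_def)
      next
        case False
        then have "canon a b (a + s, y + t) = (a + s, y + t)"
          using elim a0 b1 assms by (subst canon_of_unit) (auto simp: v)
        then show ?thesis unfolding sh unfolding m(4)
          using False elim a0 b1 assms \<open>m = a\<close> wrapV_unit[of "a + s" "y + t"]
          by (simp add: v expo_def rep_def)
      qed
    qed
  next
    case False
    then have "min (min (m - a) (1 - m)) (min y (b - y)) > 0" using m assms by auto
    from eventually_abs_less[OF this] show ?thesis
    proof eventually_elim
      case (elim v)
      obtain s t where v: "v = (s, t)" by force
      have "canon a b (m + s, y + t) = (m + s, y + t)"
        using elim a0 b1 assms by (subst canon_of_unit) (auto simp: v)
      moreover have "wrapV (m + s, y + t) = (m + s, y + t)"
        by (rule wrapV_unit) (use elim in \<open>auto simp: v\<close>)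
      ultimately show ?case unfolding sh unfolding m(4)
        using False assms by (simp add: v expo_def rep_def)
    qed
  qed
qed

text \<open>The circle at height \<open>b / 2\<close> contains the midpoint of the vertical side
  and, half a turn away, \<open>((1 + a) / 2, b / 2)\<close>. Both boundary circles contain a corner
  at the position \<open>a\<close>.\<close>

lemma horizontal_cylinder:
  "\<exists>u w h \<Phi>. cylinder a b u w h \<Phi> \<and> core_through h \<Phi> (a, b / 2) \<and> core_through h \<Phi> ((1 + a) / 2, b / 2)"
proof (intro exI conjI)
  let ?\<Phi> = "\<lambda>t r. wrapV (t, r)"
  show "cylinder a b (1, 0) (1 - a) b ?\<Phi>"
  proof (rule cylinderI)
    show "strip_iso a b (1, 0) b ?\<Phi>"
      unfolding strip_iso_def
    proof (intro allI impI conjI)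
      fix t r assume "0 < r" "r < b"
      then show "regpt a b (wrapV (t, r))" by (rule wrapV_regpt)
      show "\<forall>\<^sub>F v in nhds 0. wrapV (t + fst v, r + snd v) =
          expo a b (wrapV (t, r)) (fst v *\<^sub>R (1, 0) + snd v *\<^sub>R perp (1, 0))"
        using wrapV_expo[OF \<open>0 < r\<close> \<open>r < b\<close>, of t]
        by eventually_elim (simp add: perp_def plus_prod_def)
    qed
    show "wrapV (t + (1 - a), r) = wrapV (t, r)" for t r using wrapV_shift[of t 1 r] by simp
    show "r = r' \<and> (\<exists>n::int. t' = t + of_int n * (1 - a))" if eq: "wrapV (t, r) = wrapV (t', r')" for t r t' r'
    proof -
      obtain m n where m: "t = m + of_int n * (1 - a)" "wrapV (t, r) = (m, r)" using wrapV_reduce[of t r] by metis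
      obtain m' n' where m': "t' = m' + of_int n' * (1 - a)" "wrapV (t', r') = (m', r')" using wrapV_reduce[of t' r'] by metis
      have "m = m'" "r = r'" using eq unfolding m(2) m'(2) by auto
      then have "r = r'" "t' = t + of_int (n' - n) * (1 - a)" unfolding m(1) m'(1) by (auto simp: algebra_simps)
      then show ?thesis by blast
    qed
    fix R assume R: "R = 0 \<or> R = b"
    have c: "isCont (\<lambda>r. corner_fn a b (a, r)) R"
      unfolding corner_fn_def edge_fn_def by (intro continuous_intros)
    have c0: "corner_fn a b (a, R) = 0" using R by (auto simp: corner_fn_def edge_fn_def)
    show "\<exists>t1. \<forall>e>0. \<exists>t r. \<bar>t - t1\<bar> < e \<and> \<bar>r - R\<bar> < e \<and> 0 < r \<and> r < b \<and> corner_fn a b (wrapV (t, r)) < e"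
    proof (rule exI[of _ a], intro allI impI)
      fix e :: real assume e: "e > 0"
      obtain d where d: "d > 0" "\<And>r. \<bar>r - R\<bar> < d \<Longrightarrow> \<bar>corner_fn a b (a, r)\<bar> < e"
        using c e unfolding continuous_at_eps_delta c0 by (auto simp: dist_real_def)
      define s where "s = min (min d e) b / 2"
      have s: "0 < s" "s < d" "s < e" "s < b" using d(1) e b0 by (auto simp: s_def)
      obtain r where r: "0 < r" "r < b" "\<bar>r - R\<bar> = s"
        using R s by (elim disjE) (auto intro: that[of s] that[of "b - s"])
      have "corner_fn a b (wrapV (a, r)) < e"
        using d(2)[of r] r s a1 wrapV_unit[of a r] by auto
      then show "\<exists>t r. \<bar>t - a\<bar> < e \<and> \<bar>r - R\<bar> < e \<and> 0 < r \<and> r < b \<and> corner_fn a b (wrapV (t, r)) < e"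
        using r s e by (intro exI[of _ a] exI[of _ r]) auto
    qed
  qed (use a1 b0 in auto)
  show "core_through b ?\<Phi> (a, b/2)" "core_through b ?\<Phi> ((1 + a)/2, b/2)"
    unfolding core_through_def using wrapV_unit a1
    by (metis order_refl, auto intro!: exI[of _ "(1 + a)/2"])
qed

section \<open>Slanted cylinders from strips in the plane\<close>

text \<open>\<open>G\<close> lives in unrotated coordinates on the strip around the line x =
  \<sigma> y, with period \<open>(\<sigma> * P, P)\<close>. A rotation to the unit direction of this
  line gives the form of \<open>is_cyl\<close>, and the line through the origin becomes the
  core.\<close>

lemma cylinder_of_strip:
  fixes G :: "real \<Rightarrow> real \<Rightarrow> real \<times> real"
  assumes P: "0 < P" and \<epsilon>: "0 < \<epsilon>"
    and iso: "\<And>x y. \<bar>x - \<sigma> * y\<bar> < \<epsilon> \<Longrightarrow> regpt a b (G x y) \<and>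
       (\<forall>\<^sub>F v in nhds 0. G (x + fst v) (y + snd v) = expo a b (G x y) v)"
    and per: "\<And>x y. G (x + \<sigma> * P) (y + P) = G x y"
    and inj: "\<And>x y x' y'. \<bar>x - \<sigma> * y\<bar> < \<epsilon> \<Longrightarrow> \<bar>x' - \<sigma> * y'\<bar> < \<epsilon> \<Longrightarrow> G x y = G x' y' \<Longrightarrow>
       \<exists>n::int. x' = x + of_int n * (\<sigma> * P) \<and> y' = y + of_int n * P"
    and touch: "\<And>\<tau>. \<bar>\<tau>\<bar> = 1 \<Longrightarrow> \<exists>y0. \<forall>e>0. \<exists>x. \<bar>x - (\<sigma> * y0 + \<tau> * \<epsilon>)\<bar> < e \<and> \<bar>x - \<sigma> * y0\<bar> < \<epsilon> \<and>
       corner_fn a b (G x y0) < e"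
  shows "\<exists>u w h \<Phi>. cylinder a b u w h \<Phi> \<and> core_through h \<Phi> (G 0 0) \<and> core_through h \<Phi> (G (\<sigma> * P / 2) (P / 2))"
proof -
  define \<nu> where "\<nu> = sqrt (1 + \<sigma>\<^sup>2)"
  have \<nu>2: "\<nu> * \<nu> = 1 + \<sigma> * \<sigma>" by (simp add: \<nu>_def power2_eq_square)
  have \<nu>1: "\<nu> \<ge> 1" by (simp add: \<nu>_def)
  have \<nu>\<sigma>: "\<bar>\<sigma>\<bar> \<le> \<nu>" unfolding \<nu>_def by (rule real_le_rsqrt) simp
  define h where "h = 2 * \<epsilon> / \<nu>"
  define u where "u = (\<sigma> / \<nu>, 1 / \<nu>)"
  \<comment> \<open>\<open>(X t r, Y t r)\<close> is \<open>t\<close> times \<open>u\<close> plus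
    \<open>r - h/2\<close> times \<open>perp u\<close>, and \<open>h\<close> is the Euclidean width
    of a strip of horizontal half-width \<epsilon>.\<close>
  define X where "X = (\<lambda>t r. (t * \<sigma> - (r - h/2)) / \<nu>)"
  define Y where "Y = (\<lambda>t r. (t + (r - h/2) * \<sigma>) / \<nu>)"
  define \<Phi> where "\<Phi> = (\<lambda>t r. G (X t r) (Y t r))"
  have h: "h > 0" using \<epsilon> \<nu>1 by (simp add: h_def)
  have XY: "X t r - \<sigma> * Y t r = - (r - h/2) * \<nu>" for t r
  proof -
    have "X t r - \<sigma> * Y t r = - (r - h/2) * (1 + \<sigma> * \<sigma>) / \<nu>"
      by (simp add: X_def Y_def diff_divide_distrib add_divide_distrib algebra_simps)
    then show ?thesis using \<nu>1 by (simp add: \<nu>2[symmetric])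
  qed
  have tXY: "\<sigma> * X t r + Y t r = t * \<nu>" for t r
  proof -
    have "\<sigma> * X t r + Y t r = t * (1 + \<sigma> * \<sigma>) / \<nu>"
      by (simp add: X_def Y_def diff_divide_distrib add_divide_distrib algebra_simps)
    then show ?thesis using \<nu>1 by (simp add: \<nu>2[symmetric])
  qed
  have in_strip: "\<bar>X t r - \<sigma> * Y t r\<bar> < \<epsilon>" if "0 < r" "r < h" for t r
  proof -
    have "\<bar>r - h/2\<bar> < h/2" using that by (simp add: abs_if)
    then have "\<bar>r - h/2\<bar> * \<nu> < \<epsilon>" using \<nu>1 by (simp add: h_def field_simps)
    then show ?thesis using \<nu>1 by (simp add: XY abs_mult abs_minus_commute)
  qed
  have "cylinder a b u (P * \<nu>) h \<Phi>"
  proof (rule cylinderI)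
    have "(\<sigma> / \<nu>)\<^sup>2 + (1 / \<nu>)\<^sup>2 = (1 + \<sigma> * \<sigma>) / (\<nu> * \<nu>)"
      by (simp add: power2_eq_square add_divide_distrib)
    then show "(fst u)\<^sup>2 + (snd u)\<^sup>2 = 1" using \<nu>1 unfolding \<nu>2[symmetric] by (simp add: u_def)
    show "strip_iso a b u h \<Phi>"
      unfolding strip_iso_def
    proof (intro allI impI)
      fix t r assume r: "0 < r" "r < h"
      let ?L = "\<lambda>v::real \<times> real. fst v *\<^sub>R u + snd v *\<^sub>R perp u"
      have "isCont ?L 0" by (intro continuous_intros)
      from isCont_imp_tendsto_nhds[OF this] have "(?L \<longlongrightarrow> 0) (nhds 0)" by simp
      note comp = eventually_compose_filterlim[OF conjunct2[OF iso[OF in_strip[OF r]]] this]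
      have "\<Phi> (t + fst v) (r + snd v) = G (X t r + fst (?L v)) (Y t r + snd (?L v))" for v
        by (simp add: \<Phi>_def X_def Y_def u_def perp_def add_divide_distrib diff_divide_distrib algebra_simps)
      with comp[of t] iso[OF in_strip[OF r], of t]
      show "regpt a b (\<Phi> t r) \<and> (\<forall>\<^sub>F v in nhds 0. \<Phi> (t + fst v) (r + snd v) = expo a b (\<Phi> t r) (?L v))"
        by (simp add: \<Phi>_def)
    qed
    show "\<Phi> (t + P * \<nu>) r = \<Phi> t r" for t r
    proof -
      have "X (t + P * \<nu>) r = X t r + \<sigma> * P" "Y (t + P * \<nu>) r = Y t r + P"
        using \<nu>1 by (simp_all add: X_def Y_def field_simps)
      then show ?thesis by (simp add: \<Phi>_def per)
    qed
    show "r = r' \<and> (\<exists>n::int. t' = t + of_int n * (P * \<nu>))"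
      if r: "0 < r" "r < h" "0 < r'" "r' < h" and eq: "\<Phi> t r = \<Phi> t' r'" for t r t' r'
    proof -
      obtain n :: int where n: "X t' r' = X t r + of_int n * (\<sigma> * P)" "Y t' r' = Y t r + of_int n * P"
        using inj[OF in_strip in_strip eq[unfolded \<Phi>_def]] r by blast
      have "X t' r' - \<sigma> * Y t' r' = X t r - \<sigma> * Y t r" unfolding n by (simp add: algebra_simps)
      then have "r = r'" using \<nu>1 unfolding XY by simp
      moreover have "t' * \<nu> = t * \<nu> + of_int n * P * (1 + \<sigma> * \<sigma>)"
        using tXY[of t r] tXY[of t' r'] unfolding n by (simp add: algebra_simps)
      then have "t' * \<nu> = (t + of_int n * (P * \<nu>)) * \<nu>" unfolding \<nu>2[symmetric] by (simp add: algebra_simps)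
      then have "t' = t + of_int n * (P * \<nu>)" using \<nu>1 by simp
      ultimately show ?thesis by blast
    qed
    fix R assume R: "R = 0 \<or> R = h"
    \<comment> \<open>\<open>X - \<sigma> * Y\<close> decreases with \<open>r\<close>, so height 0
      is the right boundary of the strip.\<close>
    define \<tau> :: real where "\<tau> = (if R = 0 then 1 else -1)"
    have R\<tau>: "R = h/2 - \<tau> * \<epsilon> / \<nu>" using R h by (auto simp: \<tau>_def h_def)
    have "\<bar>\<tau>\<bar> = 1" by (simp add: \<tau>_def)
    from touch[OF this] obtain y0 where y0: "\<And>e. e > 0 \<Longrightarrow> \<exists>x. \<bar>x - (\<sigma> * y0 + \<tau> * \<epsilon>)\<bar> < e \<and> \<bar>x - \<sigma> * y0\<bar> < \<epsilon> \<and>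
       corner_fn a b (G x y0) < e" by blast
    define x0 where "x0 = \<sigma> * y0 + \<tau> * \<epsilon>"
    show "\<exists>t1. \<forall>e>0. \<exists>t r. \<bar>t - t1\<bar> < e \<and> \<bar>r - R\<bar> < e \<and> 0 < r \<and> r < h \<and> corner_fn a b (\<Phi> t r) < e"
    proof (rule exI[of _ "(\<sigma> * x0 + y0) / \<nu>"], intro allI impI)
      fix e :: real assume "e > 0"
      from y0[OF this] obtain x where x: "\<bar>x - x0\<bar> < e" "\<bar>x - \<sigma> * y0\<bar> < \<epsilon>" "corner_fn a b (G x y0) < e"
        by (auto simp: x0_def)
      define t where "t = (\<sigma> * x + y0) / \<nu>"
      define r where "r = h/2 - (x - \<sigma> * y0) / \<nu>"
      have "X t r = (x * (1 + \<sigma> * \<sigma>)) / (\<nu> * \<nu>)" "Y t r = (y0 * (1 + \<sigma> * \<sigma>)) / (\<nu> * \<nu>)"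
        using \<nu>1 by (simp_all add: X_def Y_def t_def r_def field_simps)
      then have XYx: "X t r = x" "Y t r = y0" using \<nu>1 by (simp_all add: \<nu>2[symmetric])
      have "t - (\<sigma> * x0 + y0) / \<nu> = \<sigma> / \<nu> * (x - x0)" by (simp add: t_def diff_divide_distrib algebra_simps add_divide_distrib)
      moreover have "\<bar>\<sigma> / \<nu>\<bar> \<le> 1" using \<nu>1 \<nu>\<sigma> by simp
      ultimately have "\<bar>t - (\<sigma> * x0 + y0) / \<nu>\<bar> \<le> \<bar>x - x0\<bar>"
        by (simp only: abs_mult) (rule mult_left_le_one_le; simp)
      moreover have "r - R = - 1 / \<nu> * (x - x0)"
        by (simp add: r_def R\<tau> x0_def diff_divide_distrib add_divide_distrib algebra_simps)
      moreover have "\<bar>- 1 / \<nu>\<bar> \<le> 1" using \<nu>1 by simp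
      ultimately have tr: "\<bar>t - (\<sigma> * x0 + y0) / \<nu>\<bar> \<le> \<bar>x - x0\<bar>" "\<bar>r - R\<bar> \<le> \<bar>x - x0\<bar>"
        by (simp_all only: abs_mult mult_left_le_one_le abs_ge_zero)
      have "\<bar>(x - \<sigma> * y0) / \<nu>\<bar> < h / 2" using x(2) \<nu>1 by (simp add: h_def divide_strict_right_mono)
      then have "0 < r" "r < h" unfolding r_def by linarith+
      with x tr show "\<exists>t r. \<bar>t - (\<sigma> * x0 + y0) / \<nu>\<bar> < e \<and> \<bar>r - R\<bar> < e \<and> 0 < r \<and> r < h \<and> corner_fn a b (\<Phi> t r) < e"
        by (intro exI[of _ t] exI[of _ r]) (auto simp: \<Phi>_def XYx)
    qed
  qed (use P \<nu>1 h in auto)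
  moreover have "core_through h \<Phi> (G 0 0)"
    unfolding core_through_def by (rule exI[of _ 0]) (simp add: \<Phi>_def X_def Y_def)
  moreover have "core_through h \<Phi> (G (\<sigma> * P / 2) (P / 2))"
    unfolding core_through_def using \<nu>1
    by (intro exI[of _ "P * \<nu> / 2"]) (simp add: \<Phi>_def X_def Y_def mult.commute)
  ultimately show ?thesis by blast
qed

end

text \<open>Cylinders crossing the horizontal cylinder of height \<open>b\<close> (beside the hole) once and the one of
  height \<open>1 - b\<close> (above the hole) either once (\<open>P = 1\<close>) or twice (\<open>P = 2 - b\<close>, passing the horizontal
  side of the hole in between); \<open>P\<close> is the total height climbed and \<open>\<sigma>\<close> the inverse slope. The core
  passes through \<open>G 0 0\<close> at mid height beside the hole, where the parity of \<open>N\<close> selects the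
  Weierstrass point.\<close>
locale slanted_strip = holed_torus +
  fixes N k :: int and P \<sigma> \<epsilon> :: real
  assumes P: "P = 1 \<or> P = 2 - b \<and> odd k"
    and closing: "\<sigma> * P = of_int k - of_int N * (1 - a)"
    and eps_pos: "0 < \<epsilon>"
    and eps1: "\<epsilon> \<le> ((1 - a) - \<bar>of_int N * (1 - a) + \<sigma> * b\<bar>) / 2"
    and eps2: "P \<noteq> 1 \<Longrightarrow> \<epsilon> \<le> a / 2"
    and eps_max: "\<epsilon> = ((1 - a) - \<bar>of_int N * (1 - a) + \<sigma> * b\<bar>) / 2 \<or> P \<noteq> 1 \<and> \<epsilon> = a / 2"
begin

text \<open>Unrolled position of the core at mid height of the small cylinder. With this choice the
  crossings at its top, \<open>e + \<sigma> * b / 2\<close>, and at its bottom,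
  \<open>e - \<sigma> * b / 2 - of_int N * (1 - a)\<close>, are symmetric about
  \<open>(1 + a) / 2\<close>. Their difference is the quantity inside the absolute value in
  \<open>eps1\<close>.\<close>

definition e :: real where "e = ((1 + a) + of_int N * (1 - a)) / 2"

text \<open>One period, with \<open>y = 0\<close> at mid height of the small cylinder. The change
  from \<open>b/2 + y\<close> to \<open>3*b/2 + y\<close> at \<open>y = 1 - b/2\<close> is the jump
  across the hole, from its bottom side at height 1 to its top side at \<open>1 + b\<close>.\<close>

definition G0 :: "real \<Rightarrow> real \<Rightarrow> real \<times> real" where
  "G0 x y = (if y < b/2 then wrapV (e + x, b/2 + y)
     else if y < 1 - b/2 then canon a b (e + x, b/2 + y)
     else canon a b (e + x, 3*b/2 + y))"

definition G :: "real \<Rightarrow> real \<Rightarrow> real \<times> real" where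
  "G x y = (let n = of_int \<lfloor>(y + b/2) / P\<rfloor> in G0 (x - n * (\<sigma> * P)) (y - n * P))"

lemma P_bounds: "1 \<le> P" "P \<le> 2 - b" "P \<noteq> 1 \<Longrightarrow> P = 2 - b"
  using P b1 by auto

lemma G_shift: "G (x + of_int m * (\<sigma> * P)) (y + of_int m * P) = G x y"
proof -
  have "(y + of_int m * P + b/2) / P = (y + b/2) / P + of_int m"
    using P_bounds(1) by (simp add: field_simps)
  then show ?thesis by (simp add: G_def Let_def algebra_simps)
qed

lemma G_base:
  assumes "- b/2 \<le> y" "y < P - b/2"
  shows "G x y = G0 x y"
proof -
  have "\<lfloor>(y + b/2) / P\<rfloor> = 0"
    using assms P_bounds(1) by (simp add: floor_eq_iff field_simps)
  then show ?thesis by (simp add: G_def)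
qed

lemma reduce:
  obtains m where "- b/2 \<le> y - of_int m * P" "y - of_int m * P < P - b/2"
proof -
  have "0 < P" using P_bounds(1) by simp
  from that[of "\<lfloor>(y + b/2) / P\<rfloor>"] floor_divide_lower[OF this, of "y + b/2"] floor_divide_upper[OF this, of "y + b/2"]
  show thesis by (simp add: algebra_simps)
qed

text \<open>The crossing lies at distance \<open>((1 - a) - |D|) / 2\<close> from the nearer end of
  the segment from \<open>a\<close> to 1, where D is the difference of the two crossings. By their
  symmetry the same bound serves \<open>strip_lower\<close>.\<close>

lemma strip_upper: "\<bar>x - \<sigma> * (b/2)\<bar> < \<epsilon> \<Longrightarrow> a < e + x \<and> e + x < 1"
  using eps1 unfolding e_def by (simp add: abs_if field_simps split: if_splits)

lemma strip_lower: "\<bar>x + \<sigma> * (b/2)\<bar> < \<epsilon> \<Longrightarrow> a < e + x - of_int N * (1 - a) \<and> e + x - of_int N * (1 - a) < 1"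
  using eps1 unfolding e_def by (simp add: abs_if field_simps split: if_splits)

text \<open>For odd \<open>k\<close> the point half a period from the origin is the midpoint of the
  horizontal side of the hole, which leaves the room \<open>a / 2\<close> on either side required in
  \<open>eps2\<close>.\<close>

lemma e_middle:
  assumes "P \<noteq> 1"
  obtains m :: int where "e + \<sigma> * (1 - b/2) = of_int m + a/2"
proof -
  from assms P have "odd k" by auto
  then obtain j where k: "k = 2 * j + 1" by (elim oddE)
  have "\<sigma> * (2 - b) = of_int k - of_int N * (1 - a)" using closing P_bounds(3)[OF assms] by simp
  then have "e + \<sigma> * (1 - b/2) = of_int (j + 1) + a/2"
    by (simp add: e_def k field_simps)
  then show thesis using that by blast
qed

lemma strip_middle:
  assumes "P \<noteq> 1"
  obtains m :: int where "e + \<sigma> * (1 - b/2) = of_int m + a/2"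
    "\<And>x. \<bar>x - \<sigma> * (1 - b/2)\<bar> < \<epsilon> \<Longrightarrow> 0 < e + x - of_int m \<and> e + x - of_int m < a"
proof -
  obtain m :: int where m: "e + \<sigma> * (1 - b/2) = of_int m + a/2" using e_middle[OF assms] .
  have "0 < e + x - of_int m \<and> e + x - of_int m < a" if "\<bar>x - \<sigma> * (1 - b/2)\<bar> < \<epsilon>" for x
    using that m eps2[OF assms] unfolding abs_less_iff by linarith
  with m show thesis using that by blast
qed

lemma off_hole_band: "b < y - of_int n \<Longrightarrow> y - of_int n < 1 \<Longrightarrow> off_hole (x, y)"
  using frac_eqI[of y n] b0 by (simp add: off_hole_def)

text \<open>Inside each piece \<open>G\<close> is a known chart. The content is at the seams:
  \<open>y = b/2\<close>, where the large cylinder is entered, \<open>y = 1 - b/2\<close>, where the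
  hole is crossed, and \<open>y = - b/2\<close>, below which the previous period ends.\<close>

lemma G_iso_base:
  assumes xy: "\<bar>x - \<sigma> * y\<bar> < \<epsilon>" and y: "- b/2 \<le> y" "y < P - b/2"
  shows "regpt a b (G x y) \<and> (\<forall>\<^sub>F v in nhds 0. G (x + fst v) (y + snd v) = expo a b (G x y) v)"
proof -
  have chart: ?thesis
    if "off_hole q" "G x y = canon a b q" "\<forall>\<^sub>F v in nhds 0. G (x + fst v) (y + snd v) = canon a b (q + v)" for q
    using off_hole_regpt[OF that(1)] that(2) eventually_conj[OF off_hole_expo[OF that(1)] that(3)]
    by (auto elim!: eventually_mono)
  consider (lower) "y = - b/2" | (first) "- b/2 < y" "y < b/2" | (upper) "y = b/2"
    | (band) "b/2 < y" "y < 1 - b/2" | (mid) "y = 1 - b/2" "P \<noteq> 1" | (band2) "1 - b/2 < y" "P \<noteq> 1"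
    using y by fastforce
  then show ?thesis
  proof cases
    case first
    then have "regpt a b (wrapV (e + x, b/2 + y))" by (intro wrapV_regpt) auto
    moreover have "\<forall>\<^sub>F v in nhds 0. wrapV ((e + x, b/2 + y) + v) = expo a b (wrapV (e + x, b/2 + y)) v"
      using first by (intro wrapV_expo) auto
    moreover have "\<forall>\<^sub>F v in nhds 0. G (x + fst v) (y + snd v) = wrapV ((e + x, b/2 + y) + v)"
    proof -
      have "min (y + b/2) (b/2 - y) > 0" using first by auto
      from eventually_abs_less[OF this] show ?thesis
      proof eventually_elim
        case (elim v)
        have "G (x + fst v) (y + snd v) = G0 (x + fst v) (y + snd v)"
          using elim P_bounds(1) b1 by (intro G_base) auto
        then show ?case using elim by (cases v) (auto simp: G0_def algebra_simps)
      qed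
    qed
    moreover have "G x y = wrapV (e + x, b/2 + y)" using G_base[OF y] first by (simp add: G0_def)
    ultimately show ?thesis by (auto elim: eventually_elim2)
  next
    case upper
    have s: "a < e + x" "e + x < 1" using strip_upper[of x] xy upper by auto
    show ?thesis
    proof (rule chart)
      show "off_hole (e + x, b)" using s a0 by (simp add: off_hole_def frac_unit)
      show "G x y = canon a b (e + x, b)" using G_base[OF y, of x] b1 by (simp add: upper G0_def)
      have "min (min b (1 - b)) (min (e + x - a) (1 - e - x)) > 0" using s b0 b1 by auto
      from eventually_abs_less[OF this]
      show "\<forall>\<^sub>F v in nhds 0. G (x + fst v) (y + snd v) = canon a b ((e + x, b) + v)"
      proof eventually_elim
        case (elim v)
        obtain s t where v: "v = (s, t)" by force
        have g: "G (x + fst v) (y + snd v) = G0 (x + fst v) (y + snd v)"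
          using elim P_bounds(1) b1 upper by (intro G_base) auto
        show ?case
        proof (cases "t < 0")
          case True
          have "canon a b (e + x + s, b + t) = (e + x + s, b + t)"
            using elim a0 b1 True by (subst canon_of_unit) (auto simp: v)
          moreover have "wrapV (e + x + s, b + t) = (e + x + s, b + t)"
            by (rule wrapV_unit) (use elim in \<open>auto simp: v\<close>)
          ultimately show ?thesis unfolding g using True by (simp add: upper v G0_def algebra_simps)
        next
          case False
          moreover have "b + t < 1" using elim by (auto simp: v)
          ultimately show ?thesis unfolding g by (simp add: upper v G0_def algebra_simps)
        qed
      qed
    qed
  next
    case band
    show ?thesis
    proof (rule chart)
      show "off_hole (e + x, b/2 + y)" using band by (intro off_hole_band[of _ 0]) auto
      show "G x y = canon a b (e + x, b/2 + y)" using G_base[OF y] band by (simp add: G0_def)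
      have "min (y - b/2) (1 - b/2 - y) > 0" using band by auto
      from eventually_abs_less[OF this]
      show "\<forall>\<^sub>F v in nhds 0. G (x + fst v) (y + snd v) = canon a b ((e + x, b/2 + y) + v)"
      proof eventually_elim
        case (elim v)
        have "G (x + fst v) (y + snd v) = G0 (x + fst v) (y + snd v)"
          using elim P_bounds(1) b0 band by (intro G_base) auto
        then show ?case using elim by (cases v) (auto simp: G0_def algebra_simps)
      qed
    qed
  next
    case mid
    obtain m :: int where m: "0 < e + x - of_int m" "e + x - of_int m < a"
      using strip_middle[OF mid(2)] xy mid(1) by metis
    have P2: "P = 2 - b" using P_bounds(3) mid by auto
    have cs: "canon a b (e + x + s, 1 + t) = canon a b (e + x - of_int m + s, t)"
      "canon a b (e + x + s, 1 + t) = canon a b (e + x - of_int m + s, 1 + t)" for s t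
      using frac_add_of_int_right[of "e + x - of_int m + s" m] frac_add_of_int_right[of t 1]
      by (simp_all add: canon_def algebra_simps)
    have cs2: "canon a b (e + x + s, 1 + b + t) = canon a b (e + x - of_int m + s, b + t)" for s t
      using cs(1)[of s "b + t"] by (simp add: algebra_simps)
    have Gz: "G x y = (e + x - of_int m, b)"
    proof -
      have "G x y = canon a b (e + x + 0, 1 + b + 0)" using G_base[OF y, of x] b1 by (simp add: mid(1) G0_def add.commute)
      also have "\<dots> = (e + x - of_int m, b)" unfolding cs2 using m a1 b0 b1 by (subst canon_of_unit) auto
      finally show ?thesis .
    qed
    have "regpt a b (G x y)"
      unfolding Gz regpt_def surf_iff using m a1 b0 b1 by (simp add: hole_of_unit canon_of_unit)
    \<comment> \<open>Below the seam the strip arrives at the bottom side of the hole, above it the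
      strip leaves the top side. These are the two lifts that \<open>rep\<close> uses for downward
      and other displacements.\<close>
    moreover have "\<forall>\<^sub>F v in nhds 0. G (x + fst v) (y + snd v) = expo a b (G x y) v"
    proof -
      have "min b (1 - b) > 0" using b0 b1 by auto
      from eventually_abs_less[OF this] show ?thesis
      proof eventually_elim
        case (elim v)
        obtain s t where v: "v = (s, t)" by force
        have g: "G (x + s) (y + t) = G0 (x + s) (y + t)"
          using elim P2 mid b0 b1 by (intro G_base) (auto simp: v)
        show ?case
        proof (cases "t < 0")
          case True
          then have "G (x + s) (y + t) = canon a b (e + x + s, 1 + t)"
            unfolding g using b1 elim by (simp add: mid(1) G0_def v algebra_simps)
          then show ?thesis unfolding Gz using cs(1)[of s t] True m b0 a0 by (auto simp: expo_def rep_def v)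
        next
          case False
          then have "G (x + s) (y + t) = canon a b (e + x + s, 1 + b + t)"
            unfolding g using b1 by (simp add: mid(1) G0_def algebra_simps)
          then show ?thesis unfolding Gz using cs2[of s t] False m b0 a0 by (auto simp: expo_def rep_def v)
        qed
      qed
    qed
    ultimately show ?thesis by blast
  next
    case band2
    have P2: "P = 2 - b" using P_bounds(3) band2 by auto
    show ?thesis
    proof (rule chart)
      show "off_hole (e + x, 3*b/2 + y)" using band2 y P2 by (intro off_hole_band[of _ 1]) auto
      show "G x y = canon a b (e + x, 3*b/2 + y)" using G_base[OF y] band2 b1 by (simp add: G0_def)
      have "min (y - (1 - b/2)) (P - b/2 - y) > 0" using band2 y by auto
      from eventually_abs_less[OF this]
      show "\<forall>\<^sub>F v in nhds 0. G (x + fst v) (y + snd v) = canon a b ((e + x, 3*b/2 + y) + v)"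
      proof eventually_elim
        case (elim v)
        have "G (x + fst v) (y + snd v) = G0 (x + fst v) (y + snd v)"
          using elim b0 b1 band2 by (intro G_base) auto
        then show ?case using elim b1 by (cases v) (auto simp: G0_def algebra_simps)
      qed
    qed
  next
    case lower
    \<comment> \<open>Undoing the \<open>N\<close> turns gives the actual position between
      \<open>a\<close> and 1 at which the strip enters the small cylinder.\<close>
    define X where "X = e + x - of_int N * (1 - a)"
    have s: "a < X" "X < 1" using strip_lower[of x] xy lower by (auto simp: X_def)
    have wX: "wrapV (e + x + s, t) = wrapV (X + s, t)" for s t
      using wrapV_shift[of "X + s" N t] by (simp add: X_def algebra_simps)
    show ?thesis
    proof (rule chart)
      show "off_hole (X, 0)" using s a0 by (simp add: off_hole_def frac_unit)
      have "G x y = wrapV (e + x + 0, 0)" using G_base[OF y, of x] b0 by (simp add: lower G0_def)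
      also have "\<dots> = (X, 0)" unfolding wX using s wrapV_unit[of X 0] by simp
      also have "\<dots> = canon a b (X, 0)" using s a0 b1 b0 by (subst canon_of_unit) auto
      finally show "G x y = canon a b (X, 0)" .
      have "min (min b (1 - b)) (min (X - a) (1 - X)) > 0" using s b0 b1 by auto
      from eventually_abs_less[OF this]
      show "\<forall>\<^sub>F v in nhds 0. G (x + fst v) (y + snd v) = canon a b ((X, 0) + v)"
      proof eventually_elim
        case (elim v)
        obtain s t where v: "v = (s, t)" by force
        show ?case
        proof (cases "t < 0")
          case False
          have "G (x + s) (y + t) = G0 (x + s) (y + t)"
            using elim P_bounds(1) b1 lower False by (intro G_base) (auto simp: v)
          moreover have "canon a b (X + s, t) = (X + s, t)"
            using elim a0 b1 False by (subst canon_of_unit) (auto simp: v)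
          moreover have "wrapV (X + s, t) = (X + s, t)"
            by (rule wrapV_unit) (use elim in \<open>auto simp: v\<close>)
          moreover have "t < b" using elim by (auto simp: v)
          ultimately show ?thesis using wX[of s t] by (simp add: lower v G0_def algebra_simps)
        next
          case True
          have "G (x + s) (y + t) = G (x + s + \<sigma> * P) (y + t + P)"
            using G_shift[of "x + s" 1 "y + t"] by simp
          also have "\<dots> = G0 (x + s + \<sigma> * P) (y + t + P)"
            using elim P_bounds(1) lower True b0 by (intro G_base) (auto simp: v)
          also have "\<dots> = canon a b (X + s, t)"
          proof -
            \<comment> \<open>By \<open>closing\<close>, the end of the period lies over its
              beginning, moved by the integer \<open>k\<close> sideways and by 1 or 2
              upwards.\<close>
            have A: "e + (x + s + \<sigma> * P) = X + s + of_int k" unfolding closing by (simp add: X_def)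
            have t: "- t < b" "- t < 1 - b" using elim by (auto simp: v)
            have B: "G0 (x + s + \<sigma> * P) (y + t + P) = canon a b (X + s + of_int k, t + of_int (if P = 1 then 1 else 2))"
            proof (cases "P = 1")
              case P1: True
              have "b/2 + (y + t + P) = t + of_int 1" "\<not> y + t + P < b/2" "y + t + P < 1 - b/2"
                using P1 lower t True by auto
              then show ?thesis unfolding if_P[OF P1] by (simp only: G0_def A if_True if_False)
            next
              case False
              have "3*b/2 + (y + t + P) = t + of_int 2" "\<not> y + t + P < b/2" "\<not> y + t + P < 1 - b/2"
                using P_bounds(3)[OF False] lower t b1 by auto
              then show ?thesis unfolding if_not_P[OF False] by (simp only: G0_def A if_False)
            qed
            show ?thesis unfolding B by (simp only: canon_def fst_conv snd_conv frac_add_of_int_right)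
          qed
          finally show ?thesis by (simp add: v)
        qed
      qed
    qed
  qed
qed

lemma G_iso:
  assumes "\<bar>x - \<sigma> * y\<bar> < \<epsilon>"
  shows "regpt a b (G x y) \<and> (\<forall>\<^sub>F v in nhds 0. G (x + fst v) (y + snd v) = expo a b (G x y) v)"
proof -
  obtain m where m: "- b/2 \<le> y - of_int m * P" "y - of_int m * P < P - b/2" using reduce .
  have "\<bar>x - of_int m * (\<sigma> * P) - \<sigma> * (y - of_int m * P)\<bar> < \<epsilon>" using assms by (simp add: algebra_simps)
  from G_iso_base[OF this m]
  show ?thesis
    using G_shift[of "x - of_int m * (\<sigma> * P)" m "y - of_int m * P"]
      G_shift[of "x - of_int m * (\<sigma> * P) + fst v" m "y - of_int m * P + snd v" for v]
    by (simp add: algebra_simps)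
qed

lemma G0_lower: "y < b/2 \<Longrightarrow> snd (G0 x y) = b/2 + y"
  by (simp add: G0_def wrapV_def)

lemma canon_band:
  assumes "b \<le> frac y" "frac y = b \<Longrightarrow> frac x \<noteq> 0 \<and> frac x \<noteq> a"
  shows "canon a b (x, y) = (frac x, frac y)"
  using assms b0 by (auto simp: canon_def Let_def)

lemma G0_band:
  assumes "\<bar>x - \<sigma> * y\<bar> < \<epsilon>" "b/2 \<le> y" "y < 1 - b/2"
  shows "G0 x y = (frac (e + x), b/2 + y)"
proof -
  have f: "frac (b/2 + y) = b/2 + y" using assms b0 by (intro frac_unit) auto
  have "frac (e + x) = e + x \<and> e + x > a" if "y = b/2"
    using strip_upper[of x] assms(1) that a0 by (auto intro!: frac_unit)
  then have "canon a b (e + x, b/2 + y) = (frac (e + x), b/2 + y)"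
    using assms f a0 by (subst canon_band) auto
  then show ?thesis using assms by (simp add: G0_def)
qed

lemma G0_band2:
  assumes "\<bar>x - \<sigma> * y\<bar> < \<epsilon>" "1 - b/2 \<le> y" "y < P - b/2"
  shows "G0 x y = (frac (e + x), 3*b/2 + y - 1)"
proof -
  have P1: "P \<noteq> 1" using assms by auto
  have f: "frac (3*b/2 + y) = 3*b/2 + y - 1"
    using assms b0 P_bounds(3)[OF P1] frac_eqI[of "3*b/2 + y" 1] by auto
  have "frac (e + x) \<noteq> 0 \<and> frac (e + x) \<noteq> a" if y: "y = 1 - b/2"
  proof -
    obtain m :: int where m: "0 < e + x - of_int m" "e + x - of_int m < a"
      using strip_middle[OF P1] assms(1) y by metis
    then have "frac (e + x) = e + x - of_int m" using a1 by (intro frac_eqI) auto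
    with m show ?thesis by auto
  qed
  then have "canon a b (e + x, 3*b/2 + y) = (frac (e + x), 3*b/2 + y - 1)"
    using assms f by (subst canon_band) auto
  then show ?thesis using assms b1 by (simp add: G0_def)
qed

lemma eps_half: "\<epsilon> \<le> (1 - a) / 2"
proof -
  define D where "D = of_int N * (1 - a) + \<sigma> * b"
  have "(1 - a - \<bar>D\<bar>) / 2 \<le> (1 - a) / 2" by simp
  with eps1 show ?thesis unfolding D_def[symmetric] by (rule order_trans)
qed

lemma strip_close:
  assumes "\<bar>x - \<sigma> * y\<bar> < \<epsilon>" "\<bar>x' - \<sigma> * y\<bar> < \<epsilon>"
  shows "\<bar>x - x'\<bar> < 1 - a"
proof -
  have "x - \<sigma> * y < \<epsilon>" "- \<epsilon> < x - \<sigma> * y" "x' - \<sigma> * y < \<epsilon>" "- \<epsilon> < x' - \<sigma> * y"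
    using assms by linarith+
  moreover have "2 * \<epsilon> \<le> 1 - a" using eps_half by simp
  ultimately show ?thesis by linarith
qed

text \<open>The two passes reach the same height of the large cylinder at \<open>y\<close> and at
  \<open>y + (1 - b)\<close>. Sliding both along the strip direction to the start of their passes
  puts one between \<open>a\<close> and 1 and the other, modulo 1, between 0 and
  \<open>a\<close>.\<close>

lemma bands_disjoint:
  assumes xy: "\<bar>x - \<sigma> * y\<bar> < \<epsilon>" "\<bar>x' - \<sigma> * (y + (1 - b))\<bar> < \<epsilon>" and P1: "P \<noteq> 1"
  shows "frac (e + x) \<noteq> frac (e + x')"
proof
  assume "frac (e + x) = frac (e + x')"
  then obtain i :: int where i: "x' = x + of_int i"
    by (intro that[of "\<lfloor>e + x'\<rfloor> - \<lfloor>e + x\<rfloor>"]) (simp add: frac_def)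
  define c where "c = \<sigma> * (y - b/2)"
  have "\<bar>(x - c) - \<sigma> * (b/2)\<bar> < \<epsilon>" using xy(1) by (simp add: c_def algebra_simps)
  from strip_upper[OF this] have 1: "a < e + (x - c)" "e + (x - c) < 1" by auto
  have "\<bar>(x' - c) - \<sigma> * (1 - b/2)\<bar> < \<epsilon>" using xy(2) by (simp add: c_def algebra_simps)
  then obtain m :: int where "0 < e + (x' - c) - of_int m" "e + (x' - c) - of_int m < a"
    using strip_middle[OF P1] by metis
  with 1 have "0 < of_int (m - i) + (1::real)" "of_int (m - i) < (1::real)" "of_int (m - i) \<noteq> (0::real)"
    using a0 a1 unfolding i of_int_diff by linarith+
  then have "m - i < 1" "-1 < m - i" "m - i \<noteq> 0" by linarith+
  then show False by linarith
qed

text \<open>The height in the surface separates the small cylinder from the large one and determines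
  \<open>y\<close> up to the choice of pass. At equal \<open>y\<close> two points of the strip are
  less than \<open>1 - a\<close> apart, less than either circumference; different passes are
  excluded by \<open>bands_disjoint\<close>.\<close>

lemma G0_inj:
  assumes xy: "\<bar>x - \<sigma> * y\<bar> < \<epsilon>" "- b/2 \<le> y" "y < P - b/2"
    and xy': "\<bar>x' - \<sigma> * y'\<bar> < \<epsilon>" "- b/2 \<le> y'" "y' < P - b/2"
    and eq: "G0 x y = G0 x' y'"
  shows "x = x' \<and> y = y'"
  using xy xy' eq
proof (induction y y' arbitrary: x x' rule: linorder_wlog)
  case (sym y y' x x')
  then show ?case by metis
next
  case (le y y' x x')
  note xy = le(2-4) and xy' = le(5-7) and eq = le(8)
  have cl: "\<bar>x - x'\<bar> < 1 - a" if "y = y'" using strip_close[of x y x'] le that by auto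
  consider (1) "y < b/2" "y' < b/2" | (2) "y < b/2" "b/2 \<le> y'" "y' < 1 - b/2" | (3) "y < b/2" "1 - b/2 \<le> y'"
    | (4) "b/2 \<le> y" "y < 1 - b/2" "b/2 \<le> y'" "y' < 1 - b/2"
    | (5) "b/2 \<le> y" "y < 1 - b/2" "1 - b/2 \<le> y'" | (6) "1 - b/2 \<le> y" "1 - b/2 \<le> y'"
    using le(1) by linarith
  then show ?case
  proof cases
    case 1
    then have y: "y = y'" using arg_cong[OF eq, of snd] G0_lower by simp
    have "frac ((e + x - a) / (1 - a)) = frac ((e + x' - a) / (1 - a))"
      using eq 1 a1 by (simp add: G0_def wrapV_def)
    moreover have "(e + x - a) / (1 - a) - (e + x' - a) / (1 - a) = (x - x') / (1 - a)"
      by (simp add: diff_divide_distrib[symmetric])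
    then have "\<bar>(e + x - a) / (1 - a) - (e + x' - a) / (1 - a)\<bar> < 1"
      using cl[OF y] a1 by (simp add: abs_divide)
    ultimately have "(e + x - a) / (1 - a) = (e + x' - a) / (1 - a)" by (rule frac_eq_close)
    then show ?thesis using a1 y by simp
  next
    case 2
    then show ?thesis using arg_cong[OF eq, of snd] G0_lower[of y x] G0_band[OF xy'(1)] by simp
  next
    case 3
    then show ?thesis using arg_cong[OF eq, of snd] G0_lower[of y x] G0_band2[OF xy'(1) _ xy'(3)] by simp
  next
    case 4
    then show ?thesis using eq G0_band[OF xy(1)] G0_band[OF xy'(1)] cl a0 frac_eq_close[of "e + x" "e + x'"] by auto
  next
    case 5
    then have P1: "P \<noteq> 1" using xy' by auto
    have "y' = y + (1 - b)" "frac (e + x) = frac (e + x')"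
      using eq 5 G0_band[OF xy(1)] G0_band2[OF xy'(1) _ xy'(3)] by auto
    with bands_disjoint[OF xy(1) _ P1] xy'(1) show ?thesis by auto
  next
    case 6
    then show ?thesis using eq G0_band2[OF xy(1) _ xy(3)] G0_band2[OF xy'(1) _ xy'(3)] cl a0 frac_eq_close[of "e + x" "e + x'"] by auto
  qed
qed

lemma G_inj:
  assumes "\<bar>x - \<sigma> * y\<bar> < \<epsilon>" "\<bar>x' - \<sigma> * y'\<bar> < \<epsilon>" "G x y = G x' y'"
  shows "\<exists>n::int. x' = x + of_int n * (\<sigma> * P) \<and> y' = y + of_int n * P"
proof -
  obtain m where m: "- b/2 \<le> y - of_int m * P" "y - of_int m * P < P - b/2" using reduce .
  obtain m' where m': "- b/2 \<le> y' - of_int m' * P" "y' - of_int m' * P < P - b/2" using reduce .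
  have g: "G x y = G0 (x - of_int m * (\<sigma> * P)) (y - of_int m * P)"
    if "- b/2 \<le> y - of_int m * P" "y - of_int m * P < P - b/2" for x y m
    using G_shift[of "x - of_int m * (\<sigma> * P)" m "y - of_int m * P"] G_base[OF that] by simp
  have "x - of_int m * (\<sigma> * P) = x' - of_int m' * (\<sigma> * P) \<and> y - of_int m * P = y' - of_int m' * P"
    using assms m m' g[OF m] g[OF m'] by (intro G0_inj) (simp_all add: algebra_simps)
  then show ?thesis by (intro exI[of _ "m' - m"]) (simp add: algebra_simps)
qed

text \<open>On the line of a horizontal side of the hole \<open>corner_fn\<close> reduces to
  \<open>edge_fn a\<close>, whose zeros there are corners. The witness lies
  \<open>\<tau> * s\<close> inside the boundary point of the strip.\<close>

lemma touch_line:
  assumes \<tau>: "\<bar>\<tau>\<bar> = 1" and g: "\<And>x. \<bar>x - \<sigma> * y0\<bar> < \<epsilon> \<Longrightarrow> corner_fn a b (G x y0) = \<bar>edge_fn a (c + x)\<bar>"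
    and z: "edge_fn a (c + (\<sigma> * y0 + \<tau> * \<epsilon>)) = 0" and d: "d > 0"
  shows "\<exists>x. \<bar>x - (\<sigma> * y0 + \<tau> * \<epsilon>)\<bar> < d \<and> \<bar>x - \<sigma> * y0\<bar> < \<epsilon> \<and> corner_fn a b (G x y0) < d"
proof -
  define x0 where "x0 = \<sigma> * y0 + \<tau> * \<epsilon>"
  have "isCont (\<lambda>x. edge_fn a (c + x)) x0" unfolding edge_fn_def by (intro continuous_intros)
  then obtain d' where d': "d' > 0" "\<And>x. \<bar>x - x0\<bar> < d' \<Longrightarrow> \<bar>edge_fn a (c + x)\<bar> < d"
    using d z unfolding continuous_at_eps_delta x0_def[symmetric] by (auto simp: dist_real_def)
  define s where "s = min (min d d') \<epsilon> / 2"
  have s: "0 < s" "s < d" "s < d'" "s < \<epsilon>" using d d'(1) eps_pos by (auto simp: s_def)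
  define x where "x = x0 - \<tau> * s"
  have 1: "\<bar>x - x0\<bar> = s" using \<tau> s by (simp add: x_def abs_mult)
  have "x - \<sigma> * y0 = \<tau> * (\<epsilon> - s)" by (simp add: x_def x0_def algebra_simps)
  then have 2: "\<bar>x - \<sigma> * y0\<bar> < \<epsilon>" using \<tau> s by (simp add: abs_mult)
  from g[OF 2] d'(2)[of x] 1 2 s show ?thesis unfolding x0_def[symmetric] by (intro exI[of _ x]) auto
qed

lemma edge_fn_0: "edge_fn c 0 = 0" "edge_fn c c = 0" "edge_fn c 1 = 0"
  by (simp_all add: edge_fn_def)

lemma edge_fn_add_of_int: "edge_fn c (x + of_int n) = edge_fn c x"
  by (metis edge_fn_frac frac_add_of_int_right)

text \<open>One bound on \<epsilon> is sharp. If it is \<open>a / 2\<close>, both boundary lines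
  meet corners on the side crossed at half period. Otherwise the crossings
  \<open>((1 + a) + D) / 2\<close> above and \<open>((1 + a) - D) / 2\<close> below deviate in
  opposite directions, so one boundary line meets a corner above and the other one below.\<close>

lemma G_touch:
  assumes \<tau>: "\<bar>\<tau>\<bar> = 1"
  shows "\<exists>y0. \<forall>d>0. \<exists>x. \<bar>x - (\<sigma> * y0 + \<tau> * \<epsilon>)\<bar> < d \<and> \<bar>x - \<sigma> * y0\<bar> < \<epsilon> \<and> corner_fn a b (G x y0) < d"
proof -
  define D where "D = of_int N * (1 - a) + \<sigma> * b"
  have \<tau>1: "\<tau> = 1 \<or> \<tau> = -1" using \<tau> by auto
  have "\<tau> * D = \<bar>D\<bar> \<or> \<tau> * D = - \<bar>D\<bar>" using \<tau>1 by (auto simp: abs_if)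
  then consider (middle) "P \<noteq> 1" "\<epsilon> = a / 2" | (upper) "\<epsilon> = ((1 - a) - \<bar>D\<bar>) / 2" "\<tau> * D = \<bar>D\<bar>"
    | (lower) "\<epsilon> = ((1 - a) - \<bar>D\<bar>) / 2" "\<tau> * D = - \<bar>D\<bar>"
    using eps_max unfolding D_def[symmetric] by blast
  then show ?thesis
  proof cases
    case middle
    obtain m :: int where m: "e + \<sigma> * (1 - b/2) = of_int m + a/2" using e_middle[OF middle(1)] .
    have P2: "P = 2 - b" using P_bounds(3) middle by auto
    show ?thesis
    proof (rule exI[of _ "1 - b/2"], intro allI impI, rule touch_line[OF \<tau>, where c = e])
      fix x
      have "G x (1 - b/2) = canon a b (e + x, 1 + b)"
        using G_base[of "1 - b/2" x] b0 b1 P2 by (simp add: G0_def add.commute)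
      moreover have "edge_fn b (1 + b) = 0" using edge_fn_add_of_int[of b b 1] edge_fn_0(2)[of b] by (simp add: add.commute)
      ultimately show "corner_fn a b (G x (1 - b/2)) = \<bar>edge_fn a (e + x)\<bar>"
        by (simp add: corner_fn_canon) (simp add: corner_fn_def)
    next
      have "e + (\<sigma> * (1 - b/2) + \<tau> * \<epsilon>) = (if \<tau> = 1 then a else 0) + of_int m"
        using m \<tau>1 middle by auto
      then show "edge_fn a (e + (\<sigma> * (1 - b/2) + \<tau> * \<epsilon>)) = 0"
        using edge_fn_0 by (simp add: edge_fn_add_of_int)
    qed
  next
    case upper
    show ?thesis
    proof (rule exI[of _ "b/2"], intro allI impI, rule touch_line[OF \<tau>, where c = e])
      fix x
      have "G x (b/2) = canon a b (e + x, b)"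
        using G_base[of "b/2" x] b0 b1 P_bounds(1) by (simp add: G0_def)
      then show "corner_fn a b (G x (b/2)) = \<bar>edge_fn a (e + x)\<bar>"
        using edge_fn_0(2)[of b] by (simp add: corner_fn_canon) (simp add: corner_fn_def)
    next
      have "e + (\<sigma> * (b/2) + \<tau> * \<epsilon>) = ((1 + a) + D + \<tau> * (1 - a) - \<tau> * \<bar>D\<bar>) / 2"
        unfolding upper(1) by (simp add: e_def D_def field_simps)
      also have "\<tau> * \<bar>D\<bar> = D" using upper(2) \<tau>1 by auto
      finally have "e + (\<sigma> * (b/2) + \<tau> * \<epsilon>) = (if \<tau> = 1 then 1 else a)"
        using \<tau>1 by (auto simp: field_simps)
      then show "edge_fn a (e + (\<sigma> * (b/2) + \<tau> * \<epsilon>)) = 0" using edge_fn_0 by simp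
    qed
  next
    case lower
    show ?thesis
    proof (rule exI[of _ "- b/2"], intro allI impI, rule touch_line[OF \<tau>, where c = "e - of_int N * (1 - a)"])
      fix x assume x: "\<bar>x - \<sigma> * (- b/2)\<bar> < \<epsilon>"
      have s: "a < e + x - of_int N * (1 - a)" "e + x - of_int N * (1 - a) < 1"
        using strip_lower[of x] x by auto
      have "G x (- b/2) = wrapV (e + x, 0)"
        using G_base[of "- b/2" x] b0 b1 P_bounds(1) by (simp add: G0_def)
      also have "\<dots> = wrapV (e + x - of_int N * (1 - a), 0)"
        using wrapV_shift[of "e + x - of_int N * (1 - a)" N 0] by simp
      also have "\<dots> = (e + x - of_int N * (1 - a), 0)" using s by (intro wrapV_unit) auto
      finally show "corner_fn a b (G x (- b/2)) = \<bar>edge_fn a (e - of_int N * (1 - a) + x)\<bar>"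
        using edge_fn_0(1)[of b] by (simp add: corner_fn_def algebra_simps)
    next
      have "e - of_int N * (1 - a) + (\<sigma> * (- b/2) + \<tau> * \<epsilon>) = ((1 + a) - D + \<tau> * (1 - a) - \<tau> * \<bar>D\<bar>) / 2"
        unfolding lower(1) by (simp add: e_def D_def field_simps)
      also have "\<tau> * \<bar>D\<bar> = - D" using lower(2) \<tau>1 by auto
      finally have "e - of_int N * (1 - a) + (\<sigma> * (- b/2) + \<tau> * \<epsilon>) = (if \<tau> = 1 then 1 else a)"
        using \<tau>1 by (auto simp: field_simps)
      then show "edge_fn a (e - of_int N * (1 - a) + (\<sigma> * (- b/2) + \<tau> * \<epsilon>)) = 0" using edge_fn_0 by simp
    qed
  qed
qed

lemma cylinder_G:
  "\<exists>u w h \<Phi>. cylinder a b u w h \<Phi> \<and> core_through h \<Phi> (G 0 0) \<and> core_through h \<Phi> (G (\<sigma> * P / 2) (P / 2))"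
proof (rule cylinder_of_strip)
  show "0 < P" using P_bounds(1) by simp
  show "G (x + \<sigma> * P) (y + P) = G x y" for x y using G_shift[of x 1 y] by simp
qed (use eps_pos G_iso G_inj G_touch in blast)+

text \<open>\<open>e\<close> is \<open>(1 + a) / 2\<close> moved by \<open>N\<close> half turns
  around the small cylinder, and a half turn exchanges its two Weierstrass points.\<close>

lemma G_origin: "G 0 0 = (if even N then ((1 + a) / 2, b / 2) else (a, b / 2))"
proof -
  have "G 0 0 = wrapV (e, b/2)" using G_base[of 0 0] b0 b1 P_bounds(1) by (simp add: G0_def)
  moreover have "e = (if even N then (1 + a) / 2 else a) + of_int ((N + 1) div 2) * (1 - a)"
    by (cases "even N") (auto elim!: evenE oddE simp: e_def field_simps)
  ultimately show ?thesis
    using wrapV_shift[of "if even N then (1 + a) / 2 else a" "(N + 1) div 2" "b/2"] a1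
      wrapV_unit[of "(1 + a) / 2" "b/2"] wrapV_unit[of a "b/2"] by auto
qed

lemma e_half: "e + \<sigma> * P / 2 = (1 + a) / 2 + of_int k / 2"
  unfolding closing by (simp add: e_def field_simps)

text \<open>With a single pass, half a period leads to mid height of the large cylinder,
  \<open>k\<close> half turns away from \<open>(1 + a) / 2\<close>.\<close>

lemma G_half_single:
  assumes "P = 1"
  shows "G (\<sigma> * P / 2) (P / 2) = (if even k then ((1 + a) / 2, (1 + b) / 2) else (a / 2, (1 + b) / 2))"
proof -
  have "G (\<sigma> * P / 2) (P / 2) = canon a b (e + \<sigma> * P / 2, b/2 + 1/2)"
    using G_base[of "P/2" "\<sigma> * P / 2"] b0 b1 assms by (simp add: G0_def)
  also have "e + \<sigma> * P / 2 = (if even k then (1 + a) / 2 else a / 2) + of_int ((k + 1) div 2)"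
    unfolding e_half by (cases "even k") (auto elim!: evenE oddE simp: field_simps)
  also have "canon a b (\<dots>, b/2 + 1/2) = canon a b (if even k then (1 + a) / 2 else a / 2, b/2 + 1/2)"
    by (simp only: canon_def fst_conv snd_conv frac_add_of_int_right)
  also have "\<dots> = (if even k then ((1 + a) / 2, (1 + b) / 2) else (a / 2, (1 + b) / 2))"
    using a0 a1 b0 b1 by (auto simp: canon_of_unit field_simps)
  finally show ?thesis .
qed

lemma G_half_double:
  assumes "P \<noteq> 1"
  shows "G (\<sigma> * P / 2) (P / 2) = (a / 2, b)"
proof -
  have k: "odd k" and P2: "P = 2 - b" using assms P by auto
  have "G (\<sigma> * P / 2) (P / 2) = canon a b (e + \<sigma> * P / 2, 1 + b)"
  proof -
    have "- b/2 \<le> P/2" "P/2 < P - b/2" "\<not> P/2 < b/2" "\<not> P/2 < 1 - b/2" using P2 b0 b1 by auto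
    moreover have "3*b/2 + P/2 = 1 + b" unfolding P2 by (simp add: field_simps)
    ultimately show ?thesis using G_base[of "P/2" "\<sigma> * P / 2"] by (simp add: G0_def)
  qed
  also have "e + \<sigma> * P / 2 = a / 2 + of_int ((k + 1) div 2)"
    unfolding e_half using k by (auto elim!: oddE simp: field_simps)
  also have "canon a b (\<dots>, 1 + b) = canon a b (\<dots>, b + of_int 1)" by (simp add: add.commute)
  also have "\<dots> = canon a b (a / 2, b)"
    by (simp only: canon_def fst_conv snd_conv frac_add_of_int_right)
  also have "\<dots> = (a / 2, b)"
    using a0 a1 b0 b1 by (auto simp: canon_of_unit)
  finally show ?thesis .
qed

end

section \<open>Choice of the twist number\<close>

text \<open>The step \<open>2 * s\<close> is shorter than the window of length \<open>2 * c\<close>.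
  The factor 2 is there because the parity of the twist number is prescribed.\<close>

lemma exists_int_near:
  fixes x s c :: real
  assumes "0 < s" "s < c"
  shows "\<exists>n::int. \<bar>2 * of_int n * s + x\<bar> < c"
proof -
  define n where "n = - round (x / (2 * s))"
  have "\<bar>of_int (round (x / (2 * s))) - x / (2 * s)\<bar> \<le> 1/2" by (rule of_int_round_abs_le)
  then have "\<bar>of_int n + x / (2 * s)\<bar> \<le> 1/2" by (simp add: n_def abs_minus_commute)
  then have "\<bar>of_int n + x / (2 * s)\<bar> * (2 * s) \<le> 1/2 * (2 * s)"
    using assms by (intro mult_right_mono) auto
  also have "\<dots> < c" using assms by simp
  finally have "\<bar>of_int n + x / (2 * s)\<bar> * (2 * s) < c" .
  moreover have "\<bar>2 * of_int n * s + x\<bar> = \<bar>of_int n + x / (2 * s)\<bar> * (2 * s)"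
  proof -
    have "2 * of_int n * s + x = (of_int n + x / (2 * s)) * (2 * s)" using assms by (simp add: field_simps)
    then show ?thesis using assms by (simp add: abs_mult)
  qed
  ultimately show ?thesis by (intro exI[of _ n]) simp
qed

context holed_torus
begin

lemma slanted_single:
  assumes "P1 \<in> {((1 + a) / 2, b / 2), (a, b / 2)}" "P2 \<in> {((1 + a) / 2, (1 + b) / 2), (a / 2, (1 + b) / 2)}"
  shows "\<exists>u w h \<Phi>. cylinder a b u w h \<Phi> \<and> core_through h \<Phi> P1 \<and> core_through h \<Phi> P2"
proof -
  \<comment> \<open>Odd \<open>N\<close> makes the core start at \<open>(a, b / 2)\<close>, odd
    \<open>k\<close> makes it reach \<open>(a / 2, (1 + b) / 2)\<close>.\<close>
  define d :: int where "d = (if P1 = (a, b / 2) then 1 else 0)"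
  define k :: int where "k = (if P2 = (a / 2, (1 + b) / 2) then 1 else 0)"
  have "(1 - a) * (1 - b) < (1 - a) * 1" using a1 b0 by (intro mult_strict_left_mono) auto
  then have "0 < (1 - a) * (1 - b)" "(1 - a) * (1 - b) < 1 - a" using a1 b1 by simp_all
  from exists_int_near[OF this] obtain n :: int where n: "\<bar>2 * of_int n * ((1 - a) * (1 - b)) + (of_int d * (1 - a) * (1 - b) + of_int k * b)\<bar> < 1 - a"
    by blast
  define N where "N = 2 * n + d"
  define \<sigma> where "\<sigma> = of_int k - of_int N * (1 - a)"
  define \<epsilon> where "\<epsilon> = ((1 - a) - \<bar>of_int N * (1 - a) + \<sigma> * b\<bar>) / 2"
  have "of_int N * (1 - a) + \<sigma> * b = 2 * of_int n * ((1 - a) * (1 - b)) + (of_int d * (1 - a) * (1 - b) + of_int k * b)"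
    by (simp add: N_def \<sigma>_def algebra_simps)
  with n have e: "0 < \<epsilon>" by (simp add: \<epsilon>_def)
  interpret slanted_strip a b N k 1 \<sigma> \<epsilon>
    by unfold_locales (use e in \<open>auto simp: \<sigma>_def \<epsilon>_def\<close>)
  have "even N \<longleftrightarrow> P1 \<noteq> (a, b / 2)" by (simp add: N_def d_def)
  then have "G 0 0 = P1" using assms(1) a1 by (auto simp: G_origin)
  moreover have "G (\<sigma> * 1 / 2) (1 / 2) = P2"
    unfolding G_half_single[OF refl] using assms(2) a0 by (auto simp: k_def)
  ultimately show ?thesis using cylinder_G by simp
qed

text \<open>With a single pass the half period ends at mid height of the large cylinder; with two
  passes it ends on the horizontal side of the hole, as needed for
  \<open>(a / 2, b)\<close>.\<close>

lemma slanted_double: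
  "\<exists>u w h \<Phi>. cylinder a b u w h \<Phi> \<and> core_through h \<Phi> (a, b / 2) \<and> core_through h \<Phi> (a / 2, b)"
proof -
  have b2: "0 < 2 - b" using b1 by simp
  have "(1 - a) * (2 - 2 * b) < (1 - a) * (2 - b)" using a1 b0 by simp
  then obtain n :: int where "\<bar>2 * of_int n * ((1 - a) * (2 - 2 * b)) + ((1 - a) * (2 - 2 * b) + b)\<bar> < (1 - a) * (2 - b)"
    using exists_int_near[of "(1 - a) * (2 - 2 * b)" "(1 - a) * (2 - b)"] a1 b1 by auto
  moreover define N where "N = 2 * n + 1"
  ultimately have n: "\<bar>of_int N * ((1 - a) * (2 - 2 * b)) + b\<bar> < (1 - a) * (2 - b)"
    by (simp add: algebra_simps)
  have odd: "odd N" by (simp add: N_def)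
  define \<sigma> where "\<sigma> = (1 - of_int N * (1 - a)) / (2 - b)"
  have \<sigma>: "\<sigma> * (2 - b) = 1 - of_int N * (1 - a)" using b2 by (simp add: \<sigma>_def)
  define D where "D = of_int N * (1 - a) + \<sigma> * b"
  \<comment> \<open>Multiplying by \<open>2 - b\<close> clears the denominator of \<sigma> and makes
    the expression affine in \<open>N\<close>, with the slope for which \<open>n\<close> was
    chosen.\<close>
  have "D * (2 - b) = of_int N * (1 - a) * (2 - b) + (\<sigma> * (2 - b)) * b" by (simp add: D_def algebra_simps)
  also have "\<dots> = of_int N * ((1 - a) * (2 - 2 * b)) + b" unfolding \<sigma> by (simp add: algebra_simps)
  finally have "\<bar>D\<bar> * (2 - b) < (1 - a) * (2 - b)" using n b2 by (metis abs_mult abs_of_pos)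
  then have D: "\<bar>D\<bar> < 1 - a" using b2 by simp
  define \<epsilon> where "\<epsilon> = min (((1 - a) - \<bar>D\<bar>) / 2) (a / 2)"
  interpret slanted_strip a b N 1 "2 - b" \<sigma> \<epsilon>
    by unfold_locales (use D a0 b1 in \<open>auto simp: \<sigma> \<epsilon>_def D_def[symmetric] min_def\<close>)
  have "G 0 0 = (a, b / 2)" using G_origin by (simp add: odd)
  moreover have "G (\<sigma> * (2 - b) / 2) ((2 - b) / 2) = (a / 2, b)" using G_half_double b1 by simp
  ultimately show ?thesis using cylinder_G by simp
qed

section \<open>The five regular Weierstrass points\<close>

lemma frac_reflect_fixed:
  assumes "0 < c" "c < 1" "0 \<le> x" "x < 1" "frac (c - x) = x"
  shows "x = c / 2 \<or> x = (1 + c) / 2"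
proof (cases "x \<le> c")
  case True
  then show ?thesis using frac_unit[of "c - x"] assms by auto
next
  case False
  then show ?thesis using frac_neg_unit[of "c - x"] assms by (auto simp: field_simps)
qed

text \<open>The rotation exchanges opposite sides of the hole, which are glued, and fixes only the
  midpoint of each. Elsewhere the coordinates are \<open>a / 2\<close> and \<open>b / 2\<close>
  modulo one half, and \<open>(a / 2, b / 2)\<close> itself is the centre of the removed
  rectangle.\<close>

lemma regular_weierstrass_cases:
  assumes "p \<in> regular_weierstrass a b"
  shows "p \<in> {((1 + a) / 2, b / 2), (a / 2, (1 + b) / 2), ((1 + a) / 2, (1 + b) / 2), (a / 2, b), (a, b / 2)}"
proof -
  have reg: "regpt a b p" and inv: "canon a b (a - fst p, b - snd p) = p"
    using assms by (auto simp: regular_weierstrass_def regpt_def zero_pt_def hinv_def)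
  from reg show ?thesis
  proof (cases rule: regpt_cases)
    case (vert y)
    then have "canon a b (0, b - y) = (a, b - y)" using a0 b1 by (subst canon_of_unit) auto
    then show ?thesis using inv vert by auto
  next
    case (horiz x)
    then have "canon a b (a - x, 0) = (a - x, b)" using b0 a1 by (subst canon_of_unit) auto
    then show ?thesis using inv horiz by auto
  next
    case (off x y)
    define X where "X = frac (a - x)"
    define Y where "Y = frac (b - y)"
    have u: "0 \<le> X" "X < 1" "0 \<le> Y" "Y < 1" by (auto simp: X_def Y_def frac_lt_1)
    have "canon a b (X, Y) = (x, y)" using inv off by (simp add: X_def Y_def canon_frac)
    then have "X = x" "Y = y"
      using off a0 b0 unfolding canon_of_unit[OF u] by (auto split: if_splits)
    then have "x = a / 2 \<or> x = (1 + a) / 2" "y = b / 2 \<or> y = (1 + b) / 2"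
      using frac_reflect_fixed a0 a1 b0 b1 off by (auto simp: X_def Y_def)
    moreover have "\<not> (x = a / 2 \<and> y = b / 2)" using off a0 b0 by auto
    ultimately show ?thesis using off by auto
  qed
qed

end

section \<open>Exchange of the coordinates\<close>

lemma canon_swap: "canon b a (prod.swap p) = prod.swap (canon a b p)"
  by (auto simp: canon_def Let_def)

lemma hole_swap: "prod.swap p \<in> hole b a \<longleftrightarrow> p \<in> hole a b"
  by (auto simp: hole_def)

lemma flow_line_swap:
  assumes "flow_line a b u g I"
  shows "flow_line b a (prod.swap u) (\<lambda>t. prod.swap (g t)) I"
  unfolding flow_line_def
proof (intro ballI conjI)
  fix t assume t: "t \<in> I"
  show "prod.swap (g t) \<noteq> zero_pt b a"
    using assms t by (auto simp: flow_line_def zero_pt_def prod_eq_iff)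
  obtain \<delta> q1 q2 where d: "\<delta> > 0"
    "\<And>s. s \<in> I \<Longrightarrow> t - \<delta> < s \<and> s \<le> t \<Longrightarrow> mv q1 (s - t) u \<notin> hole a b \<and> canon a b (mv q1 (s - t) u) = g s"
    "\<And>s. s \<in> I \<Longrightarrow> t \<le> s \<and> s < t + \<delta> \<Longrightarrow> mv q2 (s - t) u \<notin> hole a b \<and> canon a b (mv q2 (s - t) u) = g s"
    using assms t unfolding flow_line_def by metis
  have mv: "mv (prod.swap q) c (prod.swap u) = prod.swap (mv q c u)" for q c by (simp add: mv_def)
  show "\<exists>\<delta>>0. \<exists>q1 q2.
     (\<forall>s\<in>I. t - \<delta> < s \<and> s \<le> t \<longrightarrow> mv q1 (s - t) (prod.swap u) \<notin> hole b a \<and> canon b a (mv q1 (s - t) (prod.swap u)) = prod.swap (g s)) \<and>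
     (\<forall>s\<in>I. t \<le> s \<and> s < t + \<delta> \<longrightarrow> mv q2 (s - t) (prod.swap u) \<notin> hole b a \<and> canon b a (mv q2 (s - t) (prod.swap u)) = prod.swap (g s))"
    by (rule exI[of _ \<delta>], rule conjI, rule d(1), rule exI[of _ "prod.swap q1"], rule exI[of _ "prod.swap q2"])
      (simp add: mv hole_swap canon_swap d)
qed

text \<open>Reversal exchanges past and future, hence the lifts \<open>q1\<close> and
  \<open>q2\<close>.\<close>

lemma flow_line_reverse:
  assumes "flow_line a b u g I"
  shows "flow_line a b (- u) (\<lambda>t. g (c - t)) ((\<lambda>t. c - t) ` I)"
  unfolding flow_line_def
proof (intro ballI conjI)
  fix t' assume "t' \<in> (\<lambda>t. c - t) ` I"
  then obtain t where t: "t \<in> I" "t' = c - t" by blast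
  show "g (c - t') \<noteq> zero_pt a b" using assms t by (simp add: flow_line_def)
  obtain \<delta> q1 q2 where d: "\<delta> > 0"
    "\<And>s. s \<in> I \<Longrightarrow> t - \<delta> < s \<and> s \<le> t \<Longrightarrow> mv q1 (s - t) u \<notin> hole a b \<and> canon a b (mv q1 (s - t) u) = g s"
    "\<And>s. s \<in> I \<Longrightarrow> t \<le> s \<and> s < t + \<delta> \<Longrightarrow> mv q2 (s - t) u \<notin> hole a b \<and> canon a b (mv q2 (s - t) u) = g s"
    using assms t unfolding flow_line_def by metis
  have mv: "mv q (t - s) (- u) = mv q (s - t) u" for q s by (simp add: mv_def algebra_simps)
  show "\<exists>\<delta>>0. \<exists>q1 q2.
     (\<forall>s\<in>(\<lambda>t. c - t) ` I. t' - \<delta> < s \<and> s \<le> t' \<longrightarrow> mv q1 (s - t') (- u) \<notin> hole a b \<and> canon a b (mv q1 (s - t') (- u)) = g (c - s)) \<and>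
     (\<forall>s\<in>(\<lambda>t. c - t) ` I. t' \<le> s \<and> s < t' + \<delta> \<longrightarrow> mv q2 (s - t') (- u) \<notin> hole a b \<and> canon a b (mv q2 (s - t') (- u)) = g (c - s))"
    by (rule exI[of _ \<delta>], rule conjI, rule d(1), rule exI[of _ q2], rule exI[of _ q1])
      (auto simp: t(2) mv d)
qed

text \<open>The exchange reverses orientation: \<open>perp (prod.swap u)\<close> is
  \<open>- prod.swap (perp u)\<close>. Running through the heights as \<open>h - r\<close> repairs
  this and leaves the core at \<open>h / 2\<close>.\<close>

lemma is_cyl_swap:
  assumes "is_cyl a b u w h \<Phi>"
  shows "is_cyl b a (prod.swap u) w h (\<lambda>t r. prod.swap (\<Phi> t (h - r)))"
  unfolding is_cyl_def
proof (intro conjI allI impI ballI)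
  show "inj_on (\<lambda>(t, r). prod.swap (\<Phi> t (h - r))) ({0..<w} \<times> {0<..<h})"
  proof (rule inj_onI, clarify)
    fix t r t' r' assume *: "t \<in> {0..<w}" "t' \<in> {0..<w}" "r \<in> {0<..<h}" "r' \<in> {0<..<h}"
      "prod.swap (\<Phi> t (h - r)) = prod.swap (\<Phi> t' (h - r'))"
    have "inj_on (\<lambda>(t, r). \<Phi> t r) ({0..<w} \<times> {0<..<h})" using assms by (simp add: is_cyl_def)
    from inj_onD[OF this, of "(t, h - r)" "(t', h - r')"] * show "t = t' \<and> r = r'"
      by (auto simp: prod.swap_def prod_eq_iff)
  qed
  show "flow_line b a (prod.swap u) (\<lambda>t. prod.swap (\<Phi> t (h - r))) UNIV" if "r \<in> {0<..<h}" for r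
    using assms that by (intro flow_line_swap) (auto simp: is_cyl_def)
  show "flow_line b a (perp (prod.swap u)) (\<lambda>r. prod.swap (\<Phi> t (h - r))) {0<..<h}" for t
  proof -
    have "flow_line a b (perp u) (\<Phi> t) {0<..<h}" using assms by (simp add: is_cyl_def)
    moreover have "x \<in> (\<lambda>t. h - t) ` {0<..<h}" if "x \<in> {0<..<h}" for x
      using that by (intro image_eqI[of _ _ "h - x"]) auto
    then have "(\<lambda>t. h - t) ` {0<..<h} = {0<..<h}" by auto
    ultimately have "flow_line b a (prod.swap (- perp u)) (\<lambda>r. prod.swap (\<Phi> t (h - r))) {0<..<h}"
      using flow_line_swap[OF flow_line_reverse[of a b "perp u" "\<Phi> t" "{0<..<h}" h]] by simp
    then show ?thesis by (simp add: perp_def uminus_prod_def)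
  qed
qed (use assms in \<open>auto simp: is_cyl_def\<close>)

lemma cyl_image_swap: "cyl_image h (\<lambda>t r. prod.swap (\<Phi> t (h - r))) = prod.swap ` cyl_image h \<Phi>"
proof
  show "cyl_image h (\<lambda>t r. prod.swap (\<Phi> t (h - r))) \<subseteq> prod.swap ` cyl_image h \<Phi>"
  proof
    fix z assume "z \<in> cyl_image h (\<lambda>t r. prod.swap (\<Phi> t (h - r)))"
    then obtain t r where "z = prod.swap (\<Phi> t (h - r))" "0 < h - r" "h - r < h"
      by (auto simp: cyl_image_def)
    then show "z \<in> prod.swap ` cyl_image h \<Phi>" unfolding cyl_image_def by blast
  qed
  show "prod.swap ` cyl_image h \<Phi> \<subseteq> cyl_image h (\<lambda>t r. prod.swap (\<Phi> t (h - r)))"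
  proof
    fix z assume "z \<in> prod.swap ` cyl_image h \<Phi>"
    then obtain t r where "z = prod.swap (\<Phi> t (h - (h - r)))" "0 < h - r" "h - r < h"
      by (auto simp: cyl_image_def)
    then show "z \<in> cyl_image h (\<lambda>t r. prod.swap (\<Phi> t (h - r)))" unfolding cyl_image_def by blast
  qed
qed

lemma cylinder_swap:
  assumes "\<exists>u w h \<Phi>. cylinder b a u w h \<Phi> \<and> core_through h \<Phi> p \<and> core_through h \<Phi> q"
  shows "\<exists>u w h \<Phi>. cylinder a b u w h \<Phi> \<and> core_through h \<Phi> (prod.swap p) \<and> core_through h \<Phi> (prod.swap q)"
proof -
  obtain u w h \<Phi> where cyl: "cylinder b a u w h \<Phi>" and core: "core_through h \<Phi> p" "core_through h \<Phi> q"
    using assms by blast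
  have "cylinder a b (prod.swap u) w h (\<lambda>t r. prod.swap (\<Phi> t (h - r)))"
    unfolding cylinder_def
  proof (intro conjI notI)
    show "is_cyl a b (prod.swap u) w h (\<lambda>t r. prod.swap (\<Phi> t (h - r)))"
      using cyl by (intro is_cyl_swap) (simp add: cylinder_def)
    assume "\<exists>u' w' h' \<Phi>'. is_cyl a b u' w' h' \<Phi>' \<and> cyl_image h (\<lambda>t r. prod.swap (\<Phi> t (h - r))) \<subset> cyl_image h' \<Phi>'"
    then obtain u' w' h' \<Phi>' where c: "is_cyl a b u' w' h' \<Phi>'"
      and "prod.swap ` cyl_image h \<Phi> \<subset> cyl_image h' \<Phi>'" unfolding cyl_image_swap by blast
    then have "prod.swap ` prod.swap ` cyl_image h \<Phi> \<subset> prod.swap ` cyl_image h' \<Phi>'"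
      by (intro image_strict_mono) (auto intro: inj_onI simp: prod_eq_iff)
    then have "cyl_image h \<Phi> \<subset> cyl_image h' (\<lambda>t r. prod.swap (\<Phi>' t (h' - r)))"
      unfolding cyl_image_swap by (simp add: image_image)
    with is_cyl_swap[OF c] cyl show False unfolding cylinder_def by blast
  qed
  moreover have "core_through h (\<lambda>t r. prod.swap (\<Phi> t (h - r))) (prod.swap z)" if "core_through h \<Phi> z" for z
    using that by (auto simp: core_through_def)
  ultimately show ?thesis using core by blast
qed

theorem theorem5p1:
  fixes a b :: real and p q :: "real \<times> real"
  assumes "in_E a b"
    and "p \<in> regular_weierstrass a b" and "q \<in> regular_weierstrass a b" and "p \<noteq> q"
  shows "\<exists>u w h \<Phi>. cylinder a b u w h \<Phi> \<and> core_through h \<Phi> p \<and> core_through h \<Phi> q"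
proof -
  interpret holed_torus a b using assms(1) by unfold_locales (auto simp: in_E_def)
  interpret swapped: holed_torus b a by unfold_locales (rule b0 b1 a0 a1)+
  define joined where "joined p q \<longleftrightarrow> (\<exists>u w h \<Phi>. cylinder a b u w h \<Phi> \<and> core_through h \<Phi> p \<and> core_through h \<Phi> q)" for p q
  have sym: "joined q p" if "joined p q" for p q using that unfolding joined_def by blast
  have 1: "joined (a, b / 2) ((1 + a) / 2, b / 2)" unfolding joined_def by (rule horizontal_cylinder)
  have 2: "joined (a / 2, b) (a / 2, (1 + b) / 2)"
    using cylinder_swap[OF swapped.horizontal_cylinder] unfolding joined_def by simp
  have 3: "joined P1 P2" if "P1 \<in> {((1 + a) / 2, b / 2), (a, b / 2)}"
    "P2 \<in> {((1 + a) / 2, (1 + b) / 2), (a / 2, (1 + b) / 2)}" for P1 P2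
    unfolding joined_def using that by (rule slanted_single)
  have 4: "joined (prod.swap P1) (prod.swap P2)" if "P1 \<in> {((1 + b) / 2, a / 2), (b, a / 2)}"
    "P2 \<in> {((1 + b) / 2, (1 + a) / 2), (b / 2, (1 + a) / 2)}" for P1 P2
    unfolding joined_def using cylinder_swap[OF swapped.slanted_single[OF that]] .
  have 5: "joined (a, b / 2) (a / 2, b)" unfolding joined_def by (rule slanted_double)
  \<comment> \<open>These are all ten pairs: one on a horizontal and one on a vertical cylinder, the
    double pass between midpoints of sides, and seven single passes, three of them after exchanging
    the coordinates. The pair \<open>((1 + a) / 2, b / 2)\<close>,
    \<open>(a / 2, (1 + b) / 2)\<close> arises both ways and is listed once.\<close>
  note pairs = 1 2 5 3[of "((1 + a) / 2, b / 2)" "((1 + a) / 2, (1 + b) / 2)", simplified]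
    3[of "((1 + a) / 2, b / 2)" "(a / 2, (1 + b) / 2)", simplified]
    3[of "(a, b / 2)" "((1 + a) / 2, (1 + b) / 2)", simplified]
    3[of "(a, b / 2)" "(a / 2, (1 + b) / 2)", simplified]
    4[of "((1 + b) / 2, a / 2)" "((1 + b) / 2, (1 + a) / 2)", simplified]
    4[of "(b, a / 2)" "((1 + b) / 2, (1 + a) / 2)", simplified]
    4[of "(b, a / 2)" "(b / 2, (1 + a) / 2)", simplified]
  have "joined p q"
    using regular_weierstrass_cases[OF assms(2)] regular_weierstrass_cases[OF assms(3)] assms(4)
    unfolding insert_iff empty_iff
    by (elim disjE; (simp only: simp_thms)?) (use pairs sym in \<open>simp_all only:\<close>)
  then show ?thesis unfolding joined_def .
qed

end
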